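(* Let $X$ be a compact metric space with metric $d$, let $T\colon X\to X$ be a homeomorphism, and let $\mu$ be a $T$-invariant Borel probability measure on $X$. Then the following statements are equivalent: (1) $(X,T)$ is $\mu$-mean equicontinuous. (2) $(X,T)$ is $\mu$-equicontinuous in the mean. (3) For any finite measurable partition $\alpha=\{A_1,\dots,A_l\}$ of $X$ and any $\varepsilon>0$ there exists $C>0$ such that $K(n,\alpha,\varepsilon)\le C$ for all $n\ge 1$. (4) For any finite measurable partition $\alpha=\{A_1,\dots,A_l\}$ of $X$ and any $\varepsilon>0$ there are $k\in\mathbb{N}$ and measurable sets $B_1,\dots,B_k$ satisfying $\mu\left(\bigcup_{i=1}^k B_i\right)>1-\varepsilon$ such that if $x,y\in B_i$ for some $1\le i\le k$, then $\limsup_{n\to\infty}H_n^\alpha(x,y)<\varepsilon$. (5) For any finite measurable partition $\alpha=\{A_1,\dots,A_l\}$ of $X$ and any $\varepsilon>0$ there are $k\in\mathbb{N}$ and measurable sets $B_1,\dots,B_k$ satisfying $\mu\left(\bigcup_{i=1}^k B_i\right)>1-\varepsilon$ such that if $x,y\in B_i$ for some $1\le i\le k$, then $H_n^\alpha(x,y)<\varepsilon$ for every $n\in\mathbb{N}$.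
   Context: $\mathbb{N}=\{1,2,\dots\}$; measurable means Borel measurable; $\#(F)$ is the number of elements of a finite set $F$. A subset $K\subset X$ is a mean equicontinuous set if for every $\epsilon>0$ there exists $\delta>0$ such that for all $x,y\in K$ with $d(x,y)<\delta$ we have $\limsup_{n\to\infty}\frac1n\sum_{i=0}^{n-1}d(T^ix,T^iy)<\epsilon$. $(X,T)$ is $\mu$-mean equicontinuous if for every $\tau>0$ there exists a measurable mean equicontinuous set $K\subset X$ with $\mu(K)>1-\tau$. A subset $K\subset X$ is an equicontinuous set in the mean if for every $\epsilon>0$ there exists $\delta>0$ such that for every $n\in\mathbb{N}$ and all $x,y\in K$ with $d(x,y)<\delta$ we have $\frac1n\sum_{i=0}^{n-1}d(T^ix,T^iy)<\epsilon$. $(X,T)$ is $\mu$-equicontinuous in the mean if for every $\tau>0$ there exists a measurable set $K\subset X$ with $\mu(K)>1-\tau$ which is an equicontinuous set in the mean. For a finite measurable partition $\alpha=\{A_1,\dots,A_l\}$ of $X$, $x\in X$ and $i\in\mathbb{Z}$, put $\alpha_i(x)=h$ when $T^ix\in A_h$. For $x,y\in X$, $n\ge1$ and $\varepsilon>0$ let $H_n^\alpha(x,y)=\frac1n\#\{0\le i\le n-1:\alpha_i(x)\ne\alpha_i(y)\}$, $B_n^\alpha(x,\varepsilon)=\{y\in X: H_n^\alpha(x,y)<\varepsilon\}$, and $K(n,\alpha,\varepsilon)=\min\{\#(F): F\subset X \text{ finite},\ \mu(\bigcup_{x\in F}B_n^\alpha(x,\varepsilon))>1-\varepsilon\}$.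 *)

theory Defs
  imports "HOL-Probability.Probability"
begin

text \<open>
  The space \<open>X\<close> is a type of class \<^class>\<open>metric_space\<close> (its compactness is a hypothesis of the
  theorem). Limits superior are taken in \<^typ>\<open>ereal\<close>, since \<open>limsup\<close> requires a complete lattice.
  All averages are indexed by \<open>n :: nat\<close>; their value at \<open>n = 0\<close> is a junk value and
  \<open>n \<ge> 1\<close> is required explicitly wherever it would matter.
\<close>

definition mean_dist :: "('a::metric_space \<Rightarrow> 'a) \<Rightarrow> nat \<Rightarrow> 'a \<Rightarrow> 'a \<Rightarrow> real" where
  "mean_dist T n x y = (\<Sum>i<n. dist ((T ^^ i) x) ((T ^^ i) y)) / real n"

definition mean_equicontinuous_set :: "('a::metric_space \<Rightarrow> 'a) \<Rightarrow> 'a set \<Rightarrow> bool" where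
  "mean_equicontinuous_set T K \<longleftrightarrow>
     (\<forall>\<epsilon>>0. \<exists>\<delta>>0. \<forall>x\<in>K. \<forall>y\<in>K. dist x y < \<delta> \<longrightarrow>
        limsup (\<lambda>n. ereal (mean_dist T n x y)) < ereal \<epsilon>)"

definition mu_mean_equicontinuous :: "'a measure \<Rightarrow> ('a::metric_space \<Rightarrow> 'a) \<Rightarrow> bool" where
  "mu_mean_equicontinuous \<mu> T \<longleftrightarrow>
     (\<forall>\<tau>>0. \<exists>K\<in>sets borel. mean_equicontinuous_set T K \<and> measure \<mu> K > 1 - \<tau>)"

definition equicontinuous_set_in_mean :: "('a::metric_space \<Rightarrow> 'a) \<Rightarrow> 'a set \<Rightarrow> bool" where
  "equicontinuous_set_in_mean T K \<longleftrightarrow>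
     (\<forall>\<epsilon>>0. \<exists>\<delta>>0. \<forall>n\<ge>1. \<forall>x\<in>K. \<forall>y\<in>K. dist x y < \<delta> \<longrightarrow> mean_dist T n x y < \<epsilon>)"

definition mu_equicontinuous_in_mean :: "'a measure \<Rightarrow> ('a::metric_space \<Rightarrow> 'a) \<Rightarrow> bool" where
  "mu_equicontinuous_in_mean \<mu> T \<longleftrightarrow>
     (\<forall>\<tau>>0. \<exists>K\<in>sets borel. equicontinuous_set_in_mean T K \<and> measure \<mu> K > 1 - \<tau>)"

text \<open>
  A finite measurable partition \<open>{A\<^sub>1, \<dots>, A\<^sub>l}\<close> is given by an enumeration \<open>A\<close> of its cells over
  \<open>{1..l}\<close>; \<^const>\<open>partition_on\<close> makes the cells nonempty, and injectivity makes cells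
  with different indices different, hence disjoint. Values of \<open>A\<close> outside \<open>{1..l}\<close> are irrelevant.
\<close>

definition measurable_partition :: "nat \<Rightarrow> (nat \<Rightarrow> 'a::metric_space set) \<Rightarrow> bool" where
  "measurable_partition l A \<longleftrightarrow>
     partition_on UNIV (A ` {1..l}) \<and> inj_on A {1..l} \<and> (\<forall>h\<in>{1..l}. A h \<in> sets borel)"

definition name_at :: "('a \<Rightarrow> 'a) \<Rightarrow> nat \<Rightarrow> (nat \<Rightarrow> 'a set) \<Rightarrow> nat \<Rightarrow> 'a \<Rightarrow> nat" where
  "name_at T l A i x = (THE h. h \<in> {1..l} \<and> (T ^^ i) x \<in> A h)"

definition hamming :: "('a \<Rightarrow> 'a) \<Rightarrow> nat \<Rightarrow> (nat \<Rightarrow> 'a set) \<Rightarrow> nat \<Rightarrow> 'a \<Rightarrow> 'a \<Rightarrow> real" where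
  "hamming T l A n x y = real (card {i. i < n \<and> name_at T l A i x \<noteq> name_at T l A i y}) / real n"

definition hamming_ball :: "('a \<Rightarrow> 'a) \<Rightarrow> nat \<Rightarrow> (nat \<Rightarrow> 'a set) \<Rightarrow> nat \<Rightarrow> 'a \<Rightarrow> real \<Rightarrow> 'a set" where
  "hamming_ball T l A n x \<epsilon> = {y. hamming T l A n x y < \<epsilon>}"

text \<open>
  For a finite partition and \<open>\<epsilon> > 0\<close> the set over which the minimum is taken is nonempty: there are
  at most \<open>l ^ n\<close> names of length \<open>n\<close>, and one point for each occurring name gives balls that cover
  the space.
\<close>

definition spanning_number ::
    "'a measure \<Rightarrow> ('a \<Rightarrow> 'a) \<Rightarrow> nat \<Rightarrow> nat \<Rightarrow> (nat \<Rightarrow> 'a set) \<Rightarrow> real \<Rightarrow> nat" where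
  "spanning_number \<mu> T n l A \<epsilon> =
     (LEAST m. \<exists>F. finite F \<and> card F = m \<and>
        measure \<mu> (\<Union>x\<in>F. hamming_ball T l A n x \<epsilon>) > 1 - \<epsilon>)"

end

theory Submission
  imports Defs
begin

text \<open>
  The hard implication is from bounded spanning numbers to (4). On the product system the Hamming
  averages converge almost everywhere by Birkhoff's theorem (derived from Garsia's maximal
  inequality), so their upper limit \<open>D\<close> is a pseudometric with \<open>D = lim H\<^sub>n\<close> almost everywhere. If
  at most \<open>k\<close> Hamming balls cover most of the space for every \<open>n\<close>, then any set \<open>E\<close> of measure
  above \<open>\<epsilon>\<close> contains pairs with \<open>H\<^sub>n < 2\<epsilon>\<close> in measure bounded away from zero, hence pairs with
  \<open>D \<le> 2\<epsilon>\<close> in positive measure. Applied to the set of points whose \<open>D\<close>-ball is null, this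
  shows that almost every \<open>D\<close>-ball has positive measure, and a maximal family of disjoint balls
  yields the cover. Uniformity in \<open>n\<close>, in (4) to (5) and in (1) to (2), comes from discarding a
  small set to make the threshold time uniform and treating the finitely many earlier times
  separately. Lusin-type sets, on which a finitely valued Borel map is locally constant at a
  uniform scale, translate between names and distances.
\<close>

section \<open>The pointwise ergodic theorem\<close>

text \<open>Bounded spanning numbers give close pairs at each time \<open>n\<close>, but with
  centres that change with \<open>n\<close>. Passing to infinitely many times therefore bounds only
  the lower limit of the Hamming averages, while (4) speaks about the upper one; Birkhoff's theorem
  on the product is what closes this gap. The product need not be ergodic, so the limit depends on
  the pair, and the argument aims at a set of pairs of positive measure rather than at a constant.
  Boundedness in \<open>n\<close> is used in one place: the pigeonhole bound
  \<open>((prob E - e) / k)\<^sup>2\<close> does not depend on \<open>n\<close>. Between names and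
  distances the obstacle is that labels are only measurable. Going from (2) to (3), a Lusin set for
  the label is visited along whole orbits, and the time spent outside it must be paid for. Going
  from (5) to (2), the label records which covering set contains the starting point, so its Lusin
  set is needed at time \<open>0\<close> only.\<close>

locale measure_preserving_system = prob_space M for M :: "'a measure" +
  fixes T :: "'a \<Rightarrow> 'a"
  assumes T_measurable [measurable]: "T \<in> measurable M M"
    and T_invariant: "distr M M T = M"
begin

lemma funpow_measurable [measurable]: "T ^^ i \<in> measurable M M"
  by (induction i) (auto intro: measurable_comp[OF _ T_measurable])

lemma distr_funpow: "distr M M (T ^^ i) = M"
proof (induction i)
  case 0
  show ?case by (simp add: id_def)
next
  case (Suc i)
  have "distr M M (T ^^ Suc i) = distr (distr M M (T ^^ i)) M T"
    by (subst distr_distr) auto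
  also have "\<dots> = M" by (simp only: Suc T_invariant)
  finally show ?case .
qed

lemma integral_T:
  fixes f :: "'a \<Rightarrow> real"
  assumes [measurable]: "f \<in> borel_measurable M"
  shows "(\<integral>x. f (T x) \<partial>M) = (\<integral>x. f x \<partial>M)"
  using integral_distr[of T M M f] T_invariant by simp

lemma integral_funpow:
  fixes f :: "'a \<Rightarrow> real"
  assumes [measurable]: "f \<in> borel_measurable M"
  shows "(\<integral>x. f ((T ^^ i) x) \<partial>M) = (\<integral>x. f x \<partial>M)"
  using integral_distr[of "T ^^ i" M M f] distr_funpow by simp

definition bsum :: "('a \<Rightarrow> real) \<Rightarrow> nat \<Rightarrow> 'a \<Rightarrow> real" where
  "bsum f n x = (\<Sum>i<n. f ((T ^^ i) x))"

lemma bsum_measurable [measurable (raw)]: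
  assumes [measurable]: "f \<in> borel_measurable M"
  shows "bsum f n \<in> borel_measurable M"
  unfolding bsum_def by measurable

lemma bsum_0 [simp]: "bsum f 0 x = 0"
  by (simp add: bsum_def)

lemma bsum_Suc: "bsum f (Suc n) x = f x + bsum f n (T x)"
  unfolding bsum_def by (subst sum.lessThan_Suc_shift) (simp add: funpow_swap1)

lemma bsum_uminus: "bsum (\<lambda>x. - f x) n x = - bsum f n x"
  by (simp add: bsum_def sum_negf)

lemma abs_bsum_le:
  assumes "\<And>x. \<bar>f x\<bar> \<le> C"
  shows "\<bar>bsum f n x\<bar> \<le> n * C"
proof -
  have "\<bar>bsum f n x\<bar> \<le> (\<Sum>i<n. \<bar>f ((T ^^ i) x)\<bar>)"
    unfolding bsum_def by (rule sum_abs)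
  also have "\<dots> \<le> (\<Sum>i<n. C)"
    by (rule sum_mono) (rule assms)
  finally show ?thesis by simp
qed

text \<open>Garsia's argument. The maximum \<open>m\<close> includes \<open>k = 0\<close>, so
  \<open>m\<close> is nonnegative. Where it is positive it is attained at some \<open>Suc j\<close>,
  and \<open>bsum_Suc\<close> gives \<open>m x \<le> f x + m (T x)\<close>; elsewhere
  \<open>m x = 0 \<le> m (T x)\<close>. Integrating \<open>m x - m (T x)\<close> yields
  \<open>0\<close> by invariance.\<close>

lemma maximal_ergodic_finite:
  assumes [measurable]: "f \<in> borel_measurable M" and bound: "\<And>x. \<bar>f x\<bar> \<le> C"
  shows "0 \<le> (\<integral>x. f x * indicator {x. \<exists>k\<le>N. bsum f k x > 0} x \<partial>M)"
proof -
  define m where "m x = Max ((\<lambda>k. bsum f k x) ` {..N})" for x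
  have m_ge: "bsum f k x \<le> m x" if "k \<le> N" for k x
    unfolding m_def using that by (intro Max_ge) auto
  have m_ex: "\<exists>k\<le>N. m x = bsum f k x" for x
  proof -
    have "m x \<in> (\<lambda>k. bsum f k x) ` {..N}"
      unfolding m_def by (intro Max_in) auto
    then show ?thesis by auto
  qed
  have m_nonneg: "0 \<le> m x" for x
    using m_ge[of 0 x] by simp
  have m_meas [measurable]: "m \<in> borel_measurable M"
    unfolding m_def by measurable
  have m_bound: "\<bar>m x\<bar> \<le> N * C" for x
  proof -
    obtain k where k: "k \<le> N" "m x = bsum f k x" using m_ex by blast
    have "0 \<le> C" using bound[of x] by linarith
    then show ?thesis
      using k abs_bsum_le[where f=f and C=C and n=k and x=x] bound mult_right_mono[of "real k" "real N" C] by auto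
  qed
  let ?E = "{x. \<exists>k\<le>N. bsum f k x > 0}"
  have int_m: "integrable M m"
    by (rule integrable_const_bound[of _ "N * C"]) (auto simp: m_bound)
  have int_mT: "integrable M (\<lambda>x. m (T x))"
    by (rule integrable_const_bound[of _ "N * C"]) (auto simp: m_bound)
  have [measurable]: "(\<lambda>x. indicator ?E x :: real) \<in> borel_measurable M"
  proof -
    have "(\<lambda>x. indicator ?E x :: real) = (\<lambda>x. if \<exists>k\<in>{..N}. bsum f k x > 0 then 1 else 0)"
      by (auto simp: indicator_def fun_eq_iff)
    also have "\<dots> \<in> borel_measurable M" by measurable
    finally show ?thesis .
  qed
  have int_f: "integrable M (\<lambda>x. f x * indicator ?E x)"
  proof (rule integrable_const_bound[of _ C])
    show "AE x in M. norm (f x * indicator ?E x) \<le> C"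
      using bound by (auto simp: indicator_def intro: order_trans[OF abs_ge_zero])
  qed measurable
  have "m x - m (T x) \<le> f x * indicator ?E x" for x
  proof (cases "x \<in> ?E")
    case True
    then have pos: "m x > 0" using m_ge by (auto intro: less_le_trans)
    obtain k where k: "k \<le> N" "m x = bsum f k x" using m_ex by blast
    with pos obtain j where "k = Suc j" by (cases k) auto
    then show ?thesis using k m_ge[of j "T x"] True by (simp add: bsum_Suc)
  next
    case False
    then have "m x \<le> 0" using m_ex[of x] by (auto simp: not_less)
    then show ?thesis using m_nonneg[of "T x"] False by simp
  qed
  then have "(\<integral>x. m x - m (T x) \<partial>M) \<le> (\<integral>x. f x * indicator ?E x \<partial>M)"
    by (intro integral_mono Bochner_Integration.integrable_diff int_m int_mT int_f)
  moreover have "(\<integral>x. m x - m (T x) \<partial>M) = 0"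
    using int_m int_mT by (simp add: integral_T)
  ultimately show ?thesis by simp
qed

text \<open>Dominated convergence in \<open>N\<close>: at each point the truncated integrand is
  eventually constant.\<close>

lemma maximal_ergodic:
  assumes [measurable]: "f \<in> borel_measurable M" and bound: "\<And>x. \<bar>f x\<bar> \<le> C"
  shows "0 \<le> (\<integral>x. f x * indicator {x. \<exists>k. bsum f k x > 0} x \<partial>M)"
proof -
  have meas: "(\<lambda>x. f x * indicator {x. \<exists>k\<le>N. bsum f k x > 0} x) \<in> borel_measurable M" for N
  proof -
    have "(\<lambda>x. f x * indicator {x. \<exists>k\<le>N. bsum f k x > 0} x)
        = (\<lambda>x. if \<exists>k\<in>{..N}. bsum f k x > 0 then f x else 0)"
      by (auto simp: indicator_def fun_eq_iff)
    also have "\<dots> \<in> borel_measurable M" by measurable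
    finally show ?thesis .
  qed
  have meas': "(\<lambda>x. f x * indicator {x. \<exists>k. bsum f k x > 0} x) \<in> borel_measurable M"
  proof -
    have "(\<lambda>x. f x * indicator {x. \<exists>k. bsum f k x > 0} x)
        = (\<lambda>x. if \<exists>k. bsum f k x > 0 then f x else 0)"
      by (auto simp: indicator_def fun_eq_iff)
    also have "\<dots> \<in> borel_measurable M" by measurable
    finally show ?thesis .
  qed
  have "(\<lambda>N. \<integral>x. f x * indicator {x. \<exists>k\<le>N. bsum f k x > 0} x \<partial>M)
      \<longlonglongrightarrow> (\<integral>x. f x * indicator {x. \<exists>k. bsum f k x > 0} x \<partial>M)"
  proof (rule integral_dominated_convergence[where w="\<lambda>_. C"])
    show "AE x in M. (\<lambda>N. f x * indicator {x. \<exists>k\<le>N. bsum f k x > 0} x)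
        \<longlonglongrightarrow> f x * indicator {x. \<exists>k. bsum f k x > 0} x"
    proof (rule AE_I2)
      fix x
      have "eventually (\<lambda>N. f x * indicator {x. \<exists>k\<le>N. bsum f k x > 0} x
          = f x * indicator {x. \<exists>k. bsum f k x > 0} x) sequentially"
      proof (cases "\<exists>k. bsum f k x > 0")
        case True
        then obtain k where k: "bsum f k x > 0" by blast
        show ?thesis
          using eventually_ge_at_top[of k] by eventually_elim (use k in \<open>auto simp: indicator_def\<close>)
      qed (auto simp: indicator_def)
      then show "(\<lambda>N. f x * indicator {x. \<exists>k\<le>N. bsum f k x > 0} x)
          \<longlonglongrightarrow> f x * indicator {x. \<exists>k. bsum f k x > 0} x"
        by (rule tendsto_eventually)
    qed
    show "AE x in M. norm (f x * indicator {x. \<exists>k\<le>N. bsum f k x > 0} x) \<le> C" for N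
      using bound by (auto simp: indicator_def intro: order_trans[OF abs_ge_zero])
  qed (use meas meas' in auto)
  then show ?thesis
    by (rule LIMSEQ_le_const) (auto intro!: exI maximal_ergodic_finite[OF assms])
qed

text \<open>The maximal inequality is applied to \<open>(f - b)\<close> cut off outside
  \<open>E\<close>. Invariance of \<open>E\<close> makes the cut-off commute with orbit sums, so the
  set where some sum is positive is exactly \<open>E\<close>.\<close>

lemma maximal_ergodic_invariant_set:
  assumes [measurable]: "f \<in> borel_measurable M" and bound: "\<And>x. \<bar>f x\<bar> \<le> C"
    and [measurable]: "E \<in> sets M"
    and inv: "\<And>x. x \<in> space M \<Longrightarrow> T x \<in> E \<longleftrightarrow> x \<in> E"
    and large: "\<And>x. x \<in> E \<Longrightarrow> \<exists>k. bsum f k x > b * k"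
  shows "b * prob E \<le> (\<integral>x. f x * indicator E x \<partial>M)"
proof -
  define g where "g x = (f x - b) * indicator E x" for x
  have g_meas: "g \<in> borel_measurable M"
    unfolding g_def by measurable
  have g_bound: "\<bar>g x\<bar> \<le> C + \<bar>b\<bar>" for x
    using bound[of x] by (auto simp: g_def indicator_def)
  have inv': "(T ^^ i) x \<in> E \<longleftrightarrow> x \<in> E" if x: "x \<in> space M" for i x
  proof (induction i)
    case (Suc i)
    have "(T ^^ i) x \<in> space M"
      using x by (rule measurable_space[OF funpow_measurable])
    then show ?case using Suc inv by simp
  qed simp
  have bsum_g: "bsum g k x = (bsum f k x - b * k) * indicator E x" if "x \<in> space M" for k x
    using that by (auto simp: bsum_def g_def inv' indicator_def sum_subtractf)
  have set_eq: "(\<exists>k. bsum g k x > 0) \<longleftrightarrow> x \<in> E" if "x \<in> space M" for x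
    using large[of x] that by (auto simp: bsum_g indicator_def)
  have int_eq: "(\<integral>x. g x * indicator {x. \<exists>k. bsum g k x > 0} x \<partial>M) = (\<integral>x. g x * indicator E x \<partial>M)"
    by (rule Bochner_Integration.integral_cong) (auto simp: set_eq indicator_def)
  have "0 \<le> (\<integral>x. g x * indicator E x \<partial>M)"
    using maximal_ergodic[OF g_meas g_bound] unfolding int_eq .
  also have "(\<lambda>x. g x * indicator E x) = (\<lambda>x. f x * indicator E x - b * indicator E x)"
    by (auto simp: g_def indicator_def fun_eq_iff)
  also have "(\<integral>x. f x * indicator E x - b * indicator E x \<partial>M)
      = (\<integral>x. f x * indicator E x \<partial>M) - b * prob E"
  proof (subst Bochner_Integration.integral_diff)
    show "integrable M (\<lambda>x. f x * indicator E x)"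
    proof (rule integrable_const_bound[of _ C])
      show "AE x in M. norm (f x * indicator E x) \<le> C"
        using bound by (auto simp: indicator_def intro: order_trans[OF abs_ge_zero])
    qed measurable
  qed (auto intro!: integrable_mult_right simp: emeasure_eq_measure)
  finally show ?thesis by simp
qed

text \<open>For \<open>a < b\<close> the set where the lower limit is below \<open>a\<close> and the
  upper limit above \<open>b\<close> is invariant. The maximal inequality for \<open>f\<close> and
  for \<open>- f\<close> squeezes the integral of \<open>f\<close> over it between
  \<open>b * prob E\<close> and \<open>a * prob E\<close>, so it is null.\<close>

theorem birkhoff_pointwise:
  assumes [measurable]: "f \<in> borel_measurable M" and bound: "\<And>x. \<bar>f x\<bar> \<le> C"
  shows "AE x in M. limsup (\<lambda>n. ereal (bsum f n x / n)) = liminf (\<lambda>n. ereal (bsum f n x / n))"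
proof -
  define U where "U x = limsup (\<lambda>n. ereal (bsum f n x / n))" for x
  define L where "L x = liminf (\<lambda>n. ereal (bsum f n x / n))" for x
  have [measurable]: "U \<in> borel_measurable M" "L \<in> borel_measurable M"
    unfolding U_def L_def by measurable
  \<comment> \<open>The averages at \<open>T x\<close> and at \<open>x\<close> differ by one
    boundary term of order \<open>1 / n\<close>; hence both limits are \<open>T\<close>-invariant at
    every point.\<close>
  have shift: "bsum f n (T x) / n = (f ((T ^^ n) x) - f x) / n + bsum f n x / n" for n x
  proof -
    have "f x + bsum f n (T x) = bsum f n x + f ((T ^^ n) x)"
      using bsum_Suc[of f n x] by (simp add: bsum_def)
    then have "bsum f n (T x) = (f ((T ^^ n) x) - f x) + bsum f n x" by simp
    then show ?thesis by (simp add: add_divide_distrib)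
  qed
  have small: "(\<lambda>n. ereal ((f ((T ^^ n) x) - f x) / n)) \<longlonglongrightarrow> 0" for x
  proof -
    have "(\<lambda>n. (f ((T ^^ n) x) - f x) / real n) \<longlonglongrightarrow> 0"
    proof (rule Lim_null_comparison[where g="\<lambda>n. 2 * C / real n"])
      show "\<forall>\<^sub>F n in sequentially. norm ((f ((T ^^ n) x) - f x) / real n) \<le> 2 * C / real n"
      proof (intro always_eventually allI)
        fix n
        have "\<bar>f ((T ^^ n) x) - f x\<bar> \<le> 2 * C"
          using bound[of "(T ^^ n) x"] bound[of x] by linarith
        then show "norm ((f ((T ^^ n) x) - f x) / real n) \<le> 2 * C / real n"
          by (simp add: divide_right_mono)
      qed
      show "(\<lambda>n. 2 * C / real n) \<longlonglongrightarrow> 0" by (rule lim_const_over_n)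
    qed
    then show ?thesis by (simp add: zero_ereal_def)
  qed
  have U_inv: "U (T x) = U x" for x
    using ereal_limsup_lim_add[OF small, of x "\<lambda>n. ereal (bsum f n x / n)"]
    by (simp add: U_def shift)
  have L_inv: "L (T x) = L x" for x
    using ereal_liminf_lim_add[OF small, of x "\<lambda>n. ereal (bsum f n x / n)"]
    by (simp add: L_def shift)
  have null: "AE x in M. \<not> (L x < ereal a \<and> ereal b < U x)" if "a < b" for a b
  proof -
    define E where "E = {x \<in> space M. L x < ereal a \<and> ereal b < U x}"
    have E_sets [measurable]: "E \<in> sets M"
      unfolding E_def by measurable
    have E_inv: "T x \<in> E \<longleftrightarrow> x \<in> E" if "x \<in> space M" for x
      using that measurable_space[OF T_measurable that] by (simp add: E_def U_inv L_inv)
    have "b * prob E \<le> (\<integral>x. f x * indicator E x \<partial>M)"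
    proof (rule maximal_ergodic_invariant_set[OF assms E_sets E_inv])
      fix x assume "x \<in> E"
      then have "ereal b < limsup (\<lambda>n. ereal (bsum f n x / n))" by (simp add: E_def U_def)
      then have "\<exists>\<^sub>F n in sequentially. ereal b < ereal (bsum f n x / n)"
        using Limsup_bounded[where X="\<lambda>n. ereal (bsum f n x / n)" and F=sequentially and C="ereal b"]
        by (auto simp: frequently_def not_less)
      \<comment> \<open>At \<open>n = 0\<close> the average is \<open>0\<close> by convention, which
        for negative \<open>b\<close> would pass the test although \<open>bsum f 0 x > b * 0\<close>
        fails.\<close>
      then have "\<exists>\<^sub>F n in sequentially. ereal b < ereal (bsum f n x / n) \<and> n \<ge> 1"
        by (rule frequently_eventually_frequently) (rule eventually_ge_at_top)
      then obtain n where "ereal b < ereal (bsum f n x / n)" "n \<ge> 1"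
        by (auto dest: frequently_ex)
      then show "\<exists>k. bsum f k x > b * k"
        by (intro exI[of _ n]) (simp add: field_simps)
    qed
    moreover have "- a * prob E \<le> (\<integral>x. - f x * indicator E x \<partial>M)"
    proof (rule maximal_ergodic_invariant_set[OF _ _ E_sets E_inv])
      show "(\<lambda>x. - f x) \<in> borel_measurable M" by measurable
      show "\<bar>- f x\<bar> \<le> C" for x using bound by simp
      fix x assume "x \<in> E"
      then have "liminf (\<lambda>n. ereal (bsum f n x / n)) < ereal a" by (simp add: E_def L_def)
      then have "\<exists>\<^sub>F n in sequentially. ereal (bsum f n x / n) < ereal a"
        using Liminf_bounded[where X="\<lambda>n. ereal (bsum f n x / n)" and F=sequentially and C="ereal a"]
        by (auto simp: frequently_def not_less)
      then have "\<exists>\<^sub>F n in sequentially. ereal (bsum f n x / n) < ereal a \<and> n \<ge> 1"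
        by (rule frequently_eventually_frequently) (rule eventually_ge_at_top)
      then obtain n where "ereal (bsum f n x / n) < ereal a" "n \<ge> 1"
        by (auto dest: frequently_ex)
      then show "\<exists>k. bsum (\<lambda>x. - f x) k x > - a * k"
        by (intro exI[of _ n]) (simp add: field_simps bsum_uminus)
    qed
    ultimately have "(b - a) * prob E \<le> 0" by (simp add: algebra_simps)
    then have "prob E = 0"
      using \<open>a < b\<close> measure_nonneg[of M E] by (simp add: mult_le_0_iff)
    then have "E \<in> null_sets M"
      using emeasure_eq_measure by (intro null_setsI) auto
    then show ?thesis
      by (rule AE_I') (auto simp: E_def)
  qed
  \<comment> \<open>Rational thresholds suffice to separate \<open>L x\<close> from
    \<open>U x\<close>, and only countably many null sets are discarded.\<close>
  have "AE x in M. \<forall>p q :: rat. p < q \<longrightarrow>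
      \<not> (L x < ereal (real_of_rat p) \<and> ereal (real_of_rat q) < U x)"
    unfolding AE_all_countable using null by (auto simp: of_rat_less)
  then have "AE x in M. U x = L x"
  proof eventually_elim
    case (elim x)
    have "L x \<le> U x"
      unfolding L_def U_def by (rule Liminf_le_Limsup) simp
    moreover have "\<not> L x < U x"
    proof
      assume "L x < U x"
      then obtain q :: rat where q: "L x < ereal (real_of_rat q)" "ereal (real_of_rat q) < U x"
        using ereal_dense3 by blast
      then obtain p :: rat where "L x < ereal (real_of_rat p)" "ereal (real_of_rat p) < ereal (real_of_rat q)"
        using ereal_dense3 by blast
      with q elim show False by (auto simp: of_rat_less)
    qed
    ultimately show ?case by simp
  qed
  then show ?thesis by (simp add: U_def L_def)
qed

end

section \<open>Hamming averages of a labelled system\<close>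

text \<open>A partition is represented by the map sending a point to the index of its cell, so that
  names along an orbit are values \<open>c ((T ^^ i) x)\<close>.\<close>

locale labelled_system = measure_preserving_system +
  fixes c :: "'a \<Rightarrow> nat"
  assumes c_measurable [measurable]: "c \<in> measurable M (count_space UNIV)"
    and space_UNIV [simp]: "space M = UNIV"
begin

definition ham :: "nat \<Rightarrow> 'a \<Rightarrow> 'a \<Rightarrow> real" where
  "ham n x y = real (card {i. i < n \<and> c ((T ^^ i) x) \<noteq> c ((T ^^ i) y)}) / real n"

text \<open>This is the \<open>D\<close> of the overview. As an upper limit it satisfies the
  triangle inequality at every triple of points, not just almost everywhere, which matters because
  the covering argument uses individual centres.\<close>

definition lham :: "'a \<Rightarrow> 'a \<Rightarrow> ereal" where
  "lham x y = limsup (\<lambda>n. ereal (ham n x y))"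

lemma ham_eq_sum: "ham n x y = (\<Sum>i<n. of_bool (c ((T ^^ i) x) \<noteq> c ((T ^^ i) y))) / n"
proof -
  have "real (card {i. i < n \<and> c ((T ^^ i) x) \<noteq> c ((T ^^ i) y)})
      = (\<Sum>i\<in>{i\<in>{..<n}. c ((T ^^ i) x) \<noteq> c ((T ^^ i) y)}. 1)"
    by simp
  also have "\<dots> = (\<Sum>i<n. of_bool (c ((T ^^ i) x) \<noteq> c ((T ^^ i) y)))"
    by (subst sum.inter_filter) (auto simp: of_bool_def)
  finally show ?thesis by (simp add: ham_def)
qed

lemma ham_commute: "ham n x y = ham n y x"
  unfolding ham_def by metis

lemma ham_triangle: "ham n x z \<le> ham n x y + ham n y z"
proof -
  have "(\<Sum>i<n. of_bool (c ((T ^^ i) x) \<noteq> c ((T ^^ i) z)) :: real)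
      \<le> (\<Sum>i<n. of_bool (c ((T ^^ i) x) \<noteq> c ((T ^^ i) y)) + of_bool (c ((T ^^ i) y) \<noteq> c ((T ^^ i) z)))"
    by (rule sum_mono) auto
  then show ?thesis
    by (simp add: ham_eq_sum sum.distrib divide_right_mono flip: add_divide_distrib)
qed

lemma lham_commute: "lham x y = lham y x"
  unfolding lham_def by (subst ham_commute) simp

lemma lham_triangle: "lham x z \<le> lham x y + lham y z"
proof -
  have "lham x z \<le> limsup (\<lambda>n. ereal (ham n x y) + ereal (ham n y z))"
    unfolding lham_def by (intro Limsup_mono always_eventually) (simp add: ham_triangle)
  also have "\<dots> \<le> lham x y + lham y z"
    unfolding lham_def by (rule ereal_limsup_add_mono)
  finally show ?thesis .
qed

lemma lham_self [simp]: "lham x x = 0"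
  by (simp add: lham_def ham_def Limsup_const zero_ereal_def)

lemma label_neq_measurable [measurable]:
  "Measurable.pred (M \<Otimes>\<^sub>M M) (\<lambda>p. c ((T ^^ i) (fst p)) \<noteq> c ((T ^^ i) (snd p)))"
proof -
  have "Measurable.pred (M \<Otimes>\<^sub>M M) (\<lambda>p. real (c ((T ^^ i) (fst p))) \<noteq> real (c ((T ^^ i) (snd p))))"
    unfolding pred_def by (intro borel_measurable_neq) measurable
  then show ?thesis by simp
qed

lemma ham_measurable_pair [measurable]:
  "(\<lambda>p. ham n (fst p) (snd p)) \<in> borel_measurable (M \<Otimes>\<^sub>M M)"
  unfolding ham_eq_sum of_bool_def by measurable

lemma lham_measurable_pair [measurable]:
  "(\<lambda>p. lham (fst p) (snd p)) \<in> borel_measurable (M \<Otimes>\<^sub>M M)"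
  unfolding lham_def by measurable

lemma ham_measurable [measurable]: "ham n x \<in> borel_measurable M"
proof -
  have "(\<lambda>y. (x, y)) \<in> measurable M (M \<Otimes>\<^sub>M M)" by simp
  from measurable_compose[OF this ham_measurable_pair] show ?thesis by simp
qed

lemma lham_measurable [measurable]: "lham x \<in> borel_measurable M"
  unfolding lham_def by measurable

lemma ham_ball_sets [measurable]: "{y. ham n x y < e} \<in> sets M"
proof -
  have "{y \<in> space M. ham n x y < e} \<in> sets M" by measurable
  then show ?thesis by simp
qed

lemma lham_ball_sets [measurable]: "{y. lham x y \<le> e} \<in> sets M"
proof -
  have "{y \<in> space M. lham x y \<le> e} \<in> sets M" by measurable
  then show ?thesis by simp
qed

text \<open>The balls are the sections of one measurable set in the product, so Fubini's
  measurability statement applies.\<close>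

lemma lham_ball_prob_measurable [measurable]:
  "(\<lambda>x. prob {y. lham x y \<le> ereal e}) \<in> borel_measurable M"
proof -
  have "{p \<in> space (M \<Otimes>\<^sub>M M). lham (fst p) (snd p) \<le> e} \<in> sets (M \<Otimes>\<^sub>M M)" by measurable
  then have "(\<lambda>x. emeasure M (Pair x -` {p \<in> space (M \<Otimes>\<^sub>M M). lham (fst p) (snd p) \<le> e}))
      \<in> borel_measurable M"
    by (rule measurable_emeasure_Pair)
  also have "(\<lambda>x. emeasure M (Pair x -` {p \<in> space (M \<Otimes>\<^sub>M M). lham (fst p) (snd p) \<le> e}))
      = (\<lambda>x. emeasure M {y. lham x y \<le> e})"
    by (simp add: vimage_def space_pair_measure)
  finally show ?thesis unfolding measure_def by measurable
qed

lemma lham_null_ball_sets [measurable]: "{x. prob {y. lham x y \<le> ereal e} = 0} \<in> sets M"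
proof -
  have "{x \<in> space M. prob {y. lham x y \<le> ereal e} = 0} \<in> sets M" by measurable
  then show ?thesis by simp
qed

text \<open>The Hamming averages are the Birkhoff averages of the indicator of
  \<open>c x \<noteq> c y\<close> under \<open>T\<close> acting on both coordinates; this map
  preserves the product measure because the image of a product measure is the product of the
  images.\<close>

lemma AE_ham_converges:
  "AE p in M \<Otimes>\<^sub>M M. lham (fst p) (snd p) = liminf (\<lambda>n. ereal (ham n (fst p) (snd p)))"
proof -
  interpret Pair: pair_prob_space M M ..
  let ?S = "\<lambda>(x, y). (T x, T y)"
  interpret PP: measure_preserving_system "M \<Otimes>\<^sub>M M" ?S
  proof
    show "?S \<in> measurable (M \<Otimes>\<^sub>M M) (M \<Otimes>\<^sub>M M)" by measurable
    have "sigma_finite_measure (distr M M T)"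
      unfolding T_invariant by unfold_locales
    from pair_measure_distr[OF T_measurable T_measurable this]
    show "distr (M \<Otimes>\<^sub>M M) (M \<Otimes>\<^sub>M M) ?S = M \<Otimes>\<^sub>M M"
      by (simp add: T_invariant)
  qed
  have pow: "(?S ^^ i) p = ((T ^^ i) (fst p), (T ^^ i) (snd p))" for i p
    by (induction i) (auto simp: split_beta)
  define f :: "'a \<times> 'a \<Rightarrow> real" where "f p = of_bool (c (fst p) \<noteq> c (snd p))" for p
  have f_meas: "f \<in> borel_measurable (M \<Otimes>\<^sub>M M)"
    using label_neq_measurable[of 0] unfolding f_def of_bool_def by simp
  have f_bound: "\<bar>f p\<bar> \<le> 1" for p by (simp add: f_def)
  have "PP.bsum f n p / n = ham n (fst p) (snd p)" for n p
    by (simp add: PP.bsum_def pow f_def ham_eq_sum)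
  with PP.birkhoff_pointwise[OF f_meas f_bound] show ?thesis
    by (simp add: lham_def)
qed

section \<open>Finite covers by Hamming balls and by sets of small Hamming diameter\<close>

definition spanned :: "nat \<Rightarrow> nat \<Rightarrow> real \<Rightarrow> bool" where
  "spanned k n e \<longleftrightarrow> (\<exists>F. finite F \<and> card F \<le> k \<and> prob (\<Union>x\<in>F. {y. ham n x y < e}) > 1 - e)"

definition lham_coverable :: "real \<Rightarrow> bool" where
  "lham_coverable e \<longleftrightarrow> (\<exists>\<B>. finite \<B> \<and> \<B> \<subseteq> sets M \<and> prob (\<Union>\<B>) > 1 - e \<and>
     (\<forall>B\<in>\<B>. \<forall>x\<in>B. \<forall>y\<in>B. lham x y < ereal e))"

definition ham_coverable :: "real \<Rightarrow> bool" where
  "ham_coverable e \<longleftrightarrow> (\<exists>\<B>. finite \<B> \<and> \<B> \<subseteq> sets M \<and> prob (\<Union>\<B>) > 1 - e \<and>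
     (\<forall>B\<in>\<B>. \<forall>x\<in>B. \<forall>y\<in>B. \<forall>n\<ge>1. ham n x y < e))"

text \<open>The union of the balls misses less than \<open>e\<close>, so it meets \<open>E\<close>
  in measure above \<open>prob E - e\<close>, and one of the at most \<open>k\<close> balls meets
  \<open>E\<close> in at least the \<open>k\<close>-th part of that. Two points of this piece are
  \<open>2 * e\<close>-close through the centre, and the square of the piece lies in the
  product.\<close>

lemma spanned_imp_close_pairs:
  assumes sp: "spanned k n e" and [measurable]: "E \<in> sets M" and E: "prob E > e" and "k > 0"
  shows "measure (M \<Otimes>\<^sub>M M) {p \<in> E \<times> E. ham n (fst p) (snd p) < 2 * e} \<ge> ((prob E - e) / k)\<^sup>2"
proof -
  interpret Pair: pair_prob_space M M ..
  obtain F where F: "finite F" "card F \<le> k" "prob (\<Union>x\<in>F. {y. ham n x y < e}) > 1 - e"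
    using sp by (auto simp: spanned_def)
  let ?B = "\<lambda>x. E \<inter> {y. ham n x y < e}"
  let ?U = "\<Union>x\<in>F. {y. ham n x y < e}"
  have U [measurable]: "?U \<in> sets M" using F(1) by (intro sets.finite_UN) auto
  have "prob E + prob ?U = prob (E \<union> ?U) + prob (E \<inter> ?U)"
    by (simp add: finite_measure_Union' finite_measure_Diff' Int_commute)
  moreover have "prob (E \<union> ?U) \<le> 1" by simp
  ultimately have "prob E - e < prob (E \<inter> ?U)" using F(3) by linarith
  also have "E \<inter> ?U = (\<Union>x\<in>F. ?B x)" by auto
  also have "prob \<dots> \<le> (\<Sum>x\<in>F. prob (?B x))"
    by (intro finite_measure_subadditive_finite F) auto
  finally have sum: "prob E - e < (\<Sum>x\<in>F. prob (?B x))" .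
  have "\<exists>x\<in>F. prob (?B x) \<ge> (prob E - e) / k"
  proof (rule ccontr)
    assume "\<not> ?thesis"
    then have "(\<Sum>x\<in>F. prob (?B x)) \<le> (\<Sum>x\<in>F. (prob E - e) / k)"
      by (intro sum_mono) (auto simp: not_le intro: less_imp_le)
    also have "\<dots> = card F * ((prob E - e) / k)" by simp
    also have "\<dots> \<le> k * ((prob E - e) / k)"
      using F(2) E by (intro mult_right_mono) auto
    finally show False using sum \<open>k > 0\<close> by simp
  qed
  then obtain x where x: "prob (?B x) \<ge> (prob E - e) / k" by blast
  have "((prob E - e) / k)\<^sup>2 \<le> (prob (?B x))\<^sup>2"
    using x E by (intro power_mono) auto
  also have "\<dots> = measure (M \<Otimes>\<^sub>M M) (?B x \<times> ?B x)"
    by (simp add: measure_def emeasure_pair_measure_Times enn2real_mult power2_eq_square)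
  also have "\<dots> \<le> measure (M \<Otimes>\<^sub>M M) {p \<in> E \<times> E. ham n (fst p) (snd p) < 2 * e}"
  proof (rule Pair.P.finite_measure_mono)
    show "?B x \<times> ?B x \<subseteq> {p \<in> E \<times> E. ham n (fst p) (snd p) < 2 * e}"
    proof
      fix p assume "p \<in> ?B x \<times> ?B x"
      then show "p \<in> {p \<in> E \<times> E. ham n (fst p) (snd p) < 2 * e}"
        using ham_triangle[of n "fst p" "snd p" x] by (auto simp: ham_commute[of n _ x])
    qed
    have "{p \<in> space (M \<Otimes>\<^sub>M M). fst p \<in> E \<and> snd p \<in> E \<and> ham n (fst p) (snd p) < 2 * e} \<in> sets (M \<Otimes>\<^sub>M M)"
      by measurable
    also have "{p \<in> space (M \<Otimes>\<^sub>M M). fst p \<in> E \<and> snd p \<in> E \<and> ham n (fst p) (snd p) < 2 * e}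
        = {p \<in> E \<times> E. ham n (fst p) (snd p) < 2 * e}"
      by (auto simp: space_pair_measure)
    finally show "{p \<in> E \<times> E. ham n (fst p) (snd p) < 2 * e} \<in> sets (M \<Otimes>\<^sub>M M)" .
  qed
  finally show ?thesis .
qed

text \<open>If the set \<open>E\<close> of points with a null ball were larger than
  \<open>e\<close>, the pairs in \<open>E\<close> that are close at infinitely many times would have
  measure at least \<open>\<kappa>\<close>. Almost all of them would have small \<open>lham\<close>,
  but by Fubini such pairs over \<open>E\<close> form a null set.\<close>

lemma spanned_imp_small_bad_set:
  assumes sp: "\<And>n. n \<ge> 1 \<Longrightarrow> spanned k n e" and "k > 0"
  shows "prob {x. prob {y. lham x y \<le> 2 * e} = 0} \<le> e"
proof (rule ccontr)
  assume large: "\<not> ?thesis"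
  define E where "E = {x. prob {y. lham x y \<le> 2 * e} = 0}"
  interpret Pair: pair_prob_space M M ..
  have E_sets [measurable]: "E \<in> sets M"
    unfolding E_def by (rule lham_null_ball_sets)
  have E_large: "prob E > e" using large by (simp add: E_def)
  define W where "W n = {p \<in> E \<times> E. ham n (fst p) (snd p) < 2 * e}" for n
  have W_eq: "W n = {p \<in> space (M \<Otimes>\<^sub>M M). fst p \<in> E \<and> snd p \<in> E \<and> ham n (fst p) (snd p) < 2 * e}" for n
    by (auto simp: space_pair_measure W_def)
  have W_sets [measurable]: "W n \<in> sets (M \<Otimes>\<^sub>M M)" for n
    unfolding W_eq by measurable
  define \<kappa> where "\<kappa> = ((prob E - e) / k)\<^sup>2"
  have "\<kappa> > 0" using E_large \<open>k > 0\<close> by (simp add: \<kappa>_def)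
  have W_large: "measure (M \<Otimes>\<^sub>M M) (W n) \<ge> \<kappa>" if "n \<ge> 1" for n
    unfolding W_def \<kappa>_def using that sp E_large \<open>k > 0\<close> by (intro spanned_imp_close_pairs) auto
  \<comment> \<open>Starting at \<open>Suc N\<close> keeps \<open>n = 0\<close> out, for which
    \<open>W_large\<close> says nothing. The intersection of the \<open>V N\<close> consists of the
    pairs lying in infinitely many \<open>W n\<close>.\<close>
  define V where "V N = (\<Union>n\<in>{Suc N..}. W n)" for N
  have V_sets [measurable]: "V N \<in> sets (M \<Otimes>\<^sub>M M)" for N
    unfolding V_def by measurable
  have "decseq V"
    unfolding decseq_def V_def by (intro allI impI UN_mono) auto
  then have "(\<lambda>N. measure (M \<Otimes>\<^sub>M M) (V N)) \<longlonglongrightarrow> measure (M \<Otimes>\<^sub>M M) (\<Inter>N. V N)"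
    by (intro Pair.P.finite_Lim_measure_decseq) auto
  moreover have "measure (M \<Otimes>\<^sub>M M) (V N) \<ge> \<kappa>" for N
    by (rule order_trans[OF W_large[of "Suc N"] Pair.P.finite_measure_mono]) (auto simp: V_def)
  ultimately have "measure (M \<Otimes>\<^sub>M M) (\<Inter>N. V N) \<ge> \<kappa>"
    by (intro LIMSEQ_le_const) auto
  moreover have "emeasure (M \<Otimes>\<^sub>M M) (\<Inter>N. V N) = 0"
  proof -
    have "AE p in M \<Otimes>\<^sub>M M. p \<notin> (\<Inter>N. V N)"
    proof -
      define Z where "Z = {p \<in> space (M \<Otimes>\<^sub>M M). fst p \<in> E \<and> lham (fst p) (snd p) \<le> 2 * e}"
      have Z_sets [measurable]: "Z \<in> sets (M \<Otimes>\<^sub>M M)" unfolding Z_def by measurable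
      have "emeasure (M \<Otimes>\<^sub>M M) Z = (\<integral>\<^sup>+ x. emeasure M (Pair x -` Z) \<partial>M)"
        by (rule emeasure_pair_measure_alt) measurable
      also have "\<dots> = (\<integral>\<^sup>+ x. 0 \<partial>M)"
      proof (rule nn_integral_cong)
        fix x
        have "Pair x -` Z = (if x \<in> E then {y. lham x y \<le> 2 * e} else {})"
          by (auto simp: Z_def space_pair_measure)
        then show "emeasure M (Pair x -` Z) = 0"
          by (auto simp: E_def emeasure_eq_measure)
      qed
      finally have "Z \<in> null_sets (M \<Otimes>\<^sub>M M)" by (auto intro: null_setsI)
      then have "AE p in M \<Otimes>\<^sub>M M. p \<notin> Z" by (rule AE_not_in)
      with AE_ham_converges show ?thesis
      proof eventually_elim
        case (elim p)
        show ?case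
        proof
          assume p: "p \<in> (\<Inter>N. V N)"
          \<comment> \<open>Membership in infinitely many \<open>W n\<close> controls only the lower
            limit; \<open>AE_ham_converges\<close> then transfers the bound to
            \<open>lham\<close>.\<close>
          have "liminf (\<lambda>n. ereal (ham n (fst p) (snd p))) \<le> ereal (2 * e)"
          proof (rule ccontr)
            assume "\<not> ?thesis"
            then have "\<forall>\<^sub>F n in sequentially. ereal (2 * e) < ereal (ham n (fst p) (snd p))"
              by (intro less_LiminfD) (simp add: not_le)
            then obtain N where N: "\<And>n. n \<ge> N \<Longrightarrow> 2 * e < ham n (fst p) (snd p)"
              by (auto simp: eventually_sequentially)
            from p have "p \<in> V N" by blast
            then obtain n where "n \<ge> Suc N" "p \<in> W n" by (auto simp: V_def)
            with N[of n] show False by (simp add: W_def)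
          qed
          then have "lham (fst p) (snd p) \<le> 2 * e" using elim by simp
          moreover have "fst p \<in> E" using p by (auto simp: V_def W_def)
          ultimately show False using elim by (simp add: Z_def space_pair_measure)
        qed
      qed
    qed
    then show ?thesis
      by (subst (asm) AE_iff_measurable[of "\<Inter>N. V N"]) (auto simp: space_pair_measure)
  qed
  ultimately show False using \<open>\<kappa> > 0\<close> by (simp add: measure_def)
qed

text \<open>A packing argument: once almost every \<open>r\<close>-ball has positive measure, most
  points have \<open>r\<close>-balls of measure at least some fixed \<open>1 / Suc m\<close>.
  Disjoint balls of that size are few, and doubling the radius in a largest disjoint family covers
  all these points.\<close>

lemma lham_coverable_if_bounded_spanned:
  assumes sp: "\<And>e. e > 0 \<Longrightarrow> \<exists>k>0. \<forall>n\<ge>1. spanned k n e" and "e > 0"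
  shows "lham_coverable e"
proof -
  \<comment> \<open>The covering sets are balls of radius \<open>2 * r\<close>, with mutual
    distances at most \<open>4 * r\<close>, strictly below \<open>e\<close>.\<close>
  define r where "r = e / 5"
  have "r > 0" using \<open>e > 0\<close> by (simp add: r_def)
  define b where "b x = prob {y. lham x y \<le> r}" for x
  have b_meas [measurable]: "b \<in> borel_measurable M"
    unfolding b_def[abs_def] by (rule lham_ball_prob_measurable)
  \<comment> \<open>The radius \<open>r\<close> stays fixed while the spanning hypothesis is used at
    ever smaller \<open>d'\<close>: as \<open>2 * d' \<le> r\<close>, a null \<open>r\<close>-ball
    contains a null \<open>2 * d'\<close>-ball, and centres of the latter have total measure at most
    \<open>d'\<close>.\<close>
  have b_null: "prob {x. b x = 0} = 0"
  proof -
    have "prob {x. b x = 0} \<le> 0 + d" if "d > 0" for d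
    proof -
      define d' where "d' = min d (r / 2)"
      have d': "d' > 0" "d' \<le> d" "2 * d' \<le> r" using that \<open>r > 0\<close> by (auto simp: d'_def)
      obtain k where k: "k > 0" "\<And>n. n \<ge> 1 \<Longrightarrow> spanned k n d'" using sp[OF d'(1)] by blast
      have sub: "prob {y. lham x y \<le> 2 * d'} \<le> b x" for x
      proof -
        have "ereal (2 * d') \<le> ereal r" using d' by simp
        then show ?thesis
          unfolding b_def by (intro finite_measure_mono) (auto intro: order_trans)
      qed
      have "prob {x. b x = 0} \<le> prob {x. prob {y. lham x y \<le> 2 * d'} = 0}"
      proof (intro finite_measure_mono lham_null_ball_sets subsetI CollectI)
        fix x assume "x \<in> {x. b x = 0}"
        then show "prob {y. lham x y \<le> 2 * d'} = 0"
          using sub[of x] measure_nonneg[of M "{y. lham x y \<le> 2 * d'}"] by simp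
      qed
      also have "\<dots> \<le> d'" by (rule spanned_imp_small_bad_set) (use k in auto)
      finally show ?thesis using d' by simp
    qed
    then have "prob {x. b x = 0} \<le> 0" by (rule field_le_epsilon)
    then show ?thesis by (simp add: measure_le_0_iff)
  qed
  define G where "G m = {x. b x \<ge> 1 / Suc m}" for m :: nat
  have G_sets [measurable]: "G m \<in> sets M" for m
  proof -
    have "{x \<in> space M. b x \<ge> 1 / Suc m} \<in> sets M" by measurable
    then show ?thesis by (simp add: G_def)
  qed
  have "(\<lambda>m. prob (G m)) \<longlonglongrightarrow> prob (\<Union>m. G m)"
  proof (rule finite_Lim_measure_incseq)
    show "incseq G"
      unfolding incseq_def G_def by (auto intro: order_trans[rotated] simp: frac_le)
  qed auto
  moreover have "prob (\<Union>m. G m) = 1"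
  proof -
    have "(\<Union>m. G m) = space M - {x. b x = 0}"
    proof -
      have "x \<in> (\<Union>m. G m) \<longleftrightarrow> b x \<noteq> 0" for x
      proof
        assume "b x \<noteq> 0"
        then have "b x > 0" by (simp add: b_def zero_less_measure_iff)
        then obtain m where "1 / real (Suc m) < b x" using nat_approx_posE by blast
        then show "x \<in> (\<Union>m. G m)" by (auto simp: G_def intro: less_imp_le)
      next
        assume "x \<in> (\<Union>m. G m)"
        then obtain m where "1 / real (Suc m) \<le> b x" by (auto simp: G_def)
        moreover have "1 / real (Suc m) > 0" by simp
        ultimately show "b x \<noteq> 0" by linarith
      qed
      then show ?thesis by auto
    qed
    moreover have "{x. b x = 0} \<in> sets M"
    proof -
      have "{x \<in> space M. b x = 0} \<in> sets M" by measurable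
      then show ?thesis by simp
    qed
    ultimately show ?thesis using b_null by (simp only: prob_compl)
  qed
  ultimately have "\<forall>\<^sub>F m in sequentially. prob (G m) > 1 - e"
    using \<open>e > 0\<close> by (auto elim: order_tendstoD)
  then obtain m where m: "prob (G m) > 1 - e"
    by (auto simp: eventually_sequentially)
  define ball where "ball x = {y. lham x y \<le> r}" for x
  have ball_sets [measurable]: "ball x \<in> sets M" for x
    by (simp add: ball_def)
  define \<F> where "\<F> = {F. finite F \<and> F \<subseteq> G m \<and> disjoint_family_on ball F}"
  have card_le: "card F \<le> Suc m" if "F \<in> \<F>" for F
  proof -
    have F: "finite F" "F \<subseteq> G m" "disjoint_family_on ball F" using that by (auto simp: \<F>_def)
    have "card F * (1 / Suc m) = (\<Sum>x\<in>F. 1 / real (Suc m))" by simp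
    also have "\<dots> \<le> (\<Sum>x\<in>F. prob (ball x))"
      using F(2) by (intro sum_mono) (auto simp: G_def b_def ball_def)
    also have "\<dots> = prob (\<Union>x\<in>F. ball x)"
      using F by (intro finite_measure_finite_Union[symmetric]) auto
    also have "\<dots> \<le> 1" by simp
    finally show ?thesis by (simp add: field_simps)
  qed
  have "{} \<in> \<F>" by (simp add: \<F>_def disjoint_family_on_def)
  then obtain F where F: "F \<in> \<F>" "\<And>F'. F' \<in> \<F> \<Longrightarrow> card F' \<le> card F"
    using ex_has_greatest_nat[of "\<lambda>F. F \<in> \<F>" "{}" card "Suc (Suc m)"] card_le
    by (auto simp: less_Suc_eq_le)
  define \<B> where "\<B> = (\<lambda>x. {y. lham x y \<le> 2 * r}) ` F"
  have "G m \<subseteq> \<Union>\<B>"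
  proof
    fix x assume x: "x \<in> G m"
    \<comment> \<open>Otherwise \<open>x\<close> could be added to \<open>F\<close>, against
      maximality of the cardinality. It would be a new element, since its ball contains
      \<open>x\<close> and so meets itself.\<close>
    have "\<exists>z\<in>F. ball x \<inter> ball z \<noteq> {}"
    proof (rule ccontr)
      assume none: "\<not> ?thesis"
      have "x \<in> ball x" using \<open>r > 0\<close> by (simp add: ball_def)
      then have "x \<notin> F" using none by blast
      have "insert x F \<in> \<F>"
        using F(1) x none \<open>x \<notin> F\<close> by (auto simp: \<F>_def disjoint_family_on_def)
      from F(2)[OF this] show False
        using \<open>x \<notin> F\<close> F(1) by (simp add: \<F>_def)
    qed
    then obtain z w where zw: "z \<in> F" "lham x w \<le> r" "lham z w \<le> r" by (auto simp: ball_def)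
    have "lham z x \<le> lham z w + lham w x" by (rule lham_triangle)
    also have "\<dots> \<le> ereal r + ereal r" using zw by (intro add_mono) (auto simp: lham_commute)
    finally show "x \<in> \<Union>\<B>" using zw(1) by (auto simp: \<B>_def)
  qed
  then have "prob (\<Union>\<B>) \<ge> prob (G m)"
    using F(1) by (intro finite_measure_mono) (auto simp: \<B>_def \<F>_def intro!: sets.finite_UN)
  moreover have "lham x y < ereal e" if B: "B \<in> \<B>" "x \<in> B" "y \<in> B" for B x y
  proof -
    obtain z where z: "lham z x \<le> 2 * r" "lham z y \<le> 2 * r" using B by (auto simp: \<B>_def)
    have "lham x y \<le> lham x z + lham z y" by (rule lham_triangle)
    also have "\<dots> \<le> ereal (2 * r) + ereal (2 * r)" using z by (intro add_mono) (auto simp: lham_commute)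
    also have "\<dots> < ereal e" using \<open>e > 0\<close> by (simp add: r_def)
    finally show ?thesis .
  qed
  ultimately show ?thesis
    unfolding lham_coverable_def using m F(1) by (intro exI[of _ \<B>]) (auto simp: \<B>_def \<F>_def)
qed

text \<open>Each covering set is compared with one of its own points, and points that need more than
  \<open>N\<close> steps to settle are dropped. Cutting further by names of length \<open>N\<close>
  makes the averages vanish for \<open>n < N\<close>. Passing through the chosen point doubles the
  bound, hence \<open>e / 2\<close>.\<close>

lemma ham_coverable_if_lham_coverable:
  assumes cov: "lham_coverable (e / 2)" and fin: "finite (range c)" and "e > 0"
  shows "ham_coverable e"
proof -
  obtain \<B> where \<B>: "finite \<B>" "\<B> \<subseteq> sets M" "prob (\<Union>\<B>) > 1 - e / 2"
    "\<And>B x y. B \<in> \<B> \<Longrightarrow> x \<in> B \<Longrightarrow> y \<in> B \<Longrightarrow> lham x y < ereal (e / 2)"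
    using cov unfolding lham_coverable_def by blast
  define p where "p B = (SOME x. x \<in> B)" for B :: "'a set"
  have p: "p B \<in> B" if "x \<in> B" for x B
    unfolding p_def using that by (rule someI)
  \<comment> \<open>Fixing one point \<open>p B\<close> leaves countably many measurable conditions
    on the single variable \<open>y\<close>; a condition on all pairs would not be visibly
    measurable. For empty \<open>B\<close> the value \<open>p B\<close> is arbitrary and
    \<open>S N B\<close> is empty.\<close>
  define S where "S N B = {y \<in> B. \<forall>n\<ge>N. ham n (p B) y < e / 2}" for N B
  have S_sets [measurable]: "S N B \<in> sets M" if "B \<in> \<B>" for N B
  proof -
    have [measurable]: "B \<in> sets M" using that \<B>(2) by blast
    have "{y \<in> space M. y \<in> B \<and> (\<forall>n\<in>{N..}. ham n (p B) y < e / 2)} \<in> sets M"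
      by measurable
    also have "{y \<in> space M. y \<in> B \<and> (\<forall>n\<in>{N..}. ham n (p B) y < e / 2)} = S N B"
      by (auto simp: S_def)
    finally show ?thesis .
  qed
  define V where "V N = (\<Union>B\<in>\<B>. S N B)" for N
  have V_sets: "V N \<in> sets M" for N
    unfolding V_def using \<B>(1) by (intro sets.finite_UN) auto
  have "(\<lambda>N. prob (V N)) \<longlonglongrightarrow> prob (\<Union>N. V N)"
  proof (rule finite_Lim_measure_incseq)
    show "incseq V"
      unfolding incseq_def V_def S_def by (intro allI impI UN_mono) auto
  qed (use V_sets in auto)
  also have "(\<Union>N. V N) = \<Union>\<B>"
  proof (intro equalityI subsetI)
    fix y assume "y \<in> \<Union>\<B>"
    then obtain B where B: "B \<in> \<B>" "y \<in> B" by blast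
    then have "lham (p B) y < ereal (e / 2)" using \<B>(4) p by blast
    then have "\<forall>\<^sub>F n in sequentially. ereal (ham n (p B) y) < ereal (e / 2)"
      unfolding lham_def by (rule Limsup_lessD)
    then obtain N where "\<And>n. n \<ge> N \<Longrightarrow> ham n (p B) y < e / 2"
      by (auto simp: eventually_sequentially)
    then show "y \<in> (\<Union>N. V N)" using B by (auto simp: V_def S_def)
  qed (auto simp: V_def S_def)
  finally have "\<forall>\<^sub>F N in sequentially. prob (V N) > 1 - e"
    using \<B>(3) \<open>e > 0\<close> by (intro order_tendstoD) auto
  then obtain N where N: "prob (V N) > 1 - e"
    by (auto simp: eventually_sequentially)
  define names where "names = PiE {..<N} (\<lambda>_. range c)"
  have "finite names" unfolding names_def using fin by (intro finite_PiE) auto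
  define cyl where "cyl w = {y. \<forall>i\<in>{..<N}. c ((T ^^ i) y) = w i}" for w
  have cyl_sets [measurable]: "cyl w \<in> sets M" for w
  proof -
    have "{y \<in> space M. \<forall>i\<in>{..<N}. c ((T ^^ i) y) = w i} \<in> sets M" by measurable
    then show ?thesis by (simp add: cyl_def)
  qed
  define \<C> where "\<C> = (\<lambda>(B, w). S N B \<inter> cyl w) ` (\<B> \<times> names)"
  have "finite \<C>" using \<B>(1) \<open>finite names\<close> by (simp add: \<C>_def)
  moreover have "\<C> \<subseteq> sets M" by (auto simp: \<C>_def)
  moreover have "prob (\<Union>\<C>) > 1 - e"
  proof -
    have "V N \<subseteq> \<Union>\<C>"
    proof
      fix y assume "y \<in> V N"
      then obtain B where B: "B \<in> \<B>" "y \<in> S N B" by (auto simp: V_def)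
      define w where "w = restrict (\<lambda>i. c ((T ^^ i) y)) {..<N}"
      have "w \<in> names" "y \<in> cyl w" by (auto simp: w_def names_def cyl_def)
      then show "y \<in> \<Union>\<C>" using B by (auto simp: \<C>_def)
    qed
    then have "prob (V N) \<le> prob (\<Union>\<C>)"
      using \<open>finite \<C>\<close> \<open>\<C> \<subseteq> sets M\<close> by (intro finite_measure_mono sets.finite_Union) auto
    then show ?thesis using N by simp
  qed
  moreover have "ham n x y < e" if C: "C \<in> \<C>" "x \<in> C" "y \<in> C" for C x y n
  proof -
    obtain B w where xy: "x \<in> S N B" "y \<in> S N B" "x \<in> cyl w" "y \<in> cyl w"
      using C by (auto simp: \<C>_def)
    show ?thesis
    proof (cases "n \<ge> N")
      case True
      then have "ham n (p B) x < e / 2" "ham n (p B) y < e / 2"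
        using xy by (auto simp: S_def)
      then show ?thesis using ham_triangle[of n x y "p B"] by (simp add: ham_commute[of n x])
    next
      case False
      then have "{i. i < n \<and> c ((T ^^ i) x) \<noteq> c ((T ^^ i) y)} = {}"
        using xy by (auto simp: cyl_def)
      then have "ham n x y = 0" unfolding ham_def by (simp only: card.empty)
      then show ?thesis using \<open>e > 0\<close> by simp
    qed
  qed
  ultimately show ?thesis
    unfolding ham_coverable_def by (intro exI[of _ \<C>] conjI ballI allI impI)
qed

end

section \<open>Borel sets of compact metric spaces\<close>

text \<open>Regularity of finite Borel measures, by induction over the generated sigma-algebra.
  Bounding the gap \<open>U - C\<close> makes the claim symmetric under complements, which exchange
  the inner and the outer set.\<close>

lemma finite_measure_closed_open_approx:
  fixes M :: "'a::metric_space measure"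
  assumes "finite_measure M" and M: "sets M = sets borel" and "B \<in> sets borel" and "e > 0"
  shows "\<exists>C U. closed C \<and> open U \<and> C \<subseteq> B \<and> B \<subseteq> U \<and> measure M (U - C) < e"
proof -
  interpret finite_measure M by fact
  have borel_sets: "closed C \<Longrightarrow> C \<in> sets M" "open C \<Longrightarrow> C \<in> sets M" for C
    by (auto simp: M)
  have space [simp]: "space M = UNIV" using sets_eq_imp_space_eq[OF M] by simp
  have "B \<in> sigma_sets UNIV {S. open S}"
    using assms(3) by (simp add: borel_def)
  then show ?thesis using \<open>e > 0\<close>
  proof (induction B arbitrary: e rule: sigma_sets.induct)
    case (Basic S)
    then have "open S" by simp
    show ?case
    proof (cases "S = UNIV")
      \<comment> \<open>Treated apart because \<open>infdist x {} = 0\<close> by convention, so the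
        sets \<open>C n\<close> used below would be empty for \<open>S = UNIV\<close>.\<close>
      case True
      then show ?thesis using Basic by (intro exI[of _ UNIV]) auto
    next
      case False
      define C where "C n = {x. infdist x (- S) \<ge> 1 / Suc n}" for n :: nat
      have C_closed: "closed (C n)" for n
        unfolding C_def by (intro closed_Collect_le continuous_intros)
      have "(\<lambda>n. measure M (C n)) \<longlonglongrightarrow> measure M (\<Union>n. C n)"
      proof (rule finite_Lim_measure_incseq)
        show "incseq C"
          unfolding incseq_def C_def by (auto intro: order_trans[rotated] simp: frac_le)
      qed (use C_closed borel_sets in auto)
      also have "(\<Union>n. C n) = S"
      proof (intro equalityI subsetI)
        fix x assume "x \<in> S"
        then have "infdist x (- S) \<noteq> 0"
          using in_closed_iff_infdist_zero[of "- S" x] \<open>open S\<close> False by (auto simp: closed_open)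
        then have "infdist x (- S) > 0" using infdist_nonneg[of x "- S"] by linarith
        then obtain n where "1 / real (Suc n) < infdist x (- S)" using nat_approx_posE by blast
        then show "x \<in> (\<Union>n. C n)" by (auto simp: C_def intro: less_imp_le)
      next
        fix x assume "x \<in> (\<Union>n. C n)"
        then obtain n where n: "1 / real (Suc n) \<le> infdist x (- S)" by (auto simp: C_def)
        show "x \<in> S"
        proof (rule ccontr)
          assume "x \<notin> S"
          then have "infdist x (- S) = 0" by simp
          with n show False by simp
        qed
      qed
      finally have "\<forall>\<^sub>F n in sequentially. measure M (C n) > measure M S - e"
        using \<open>e > 0\<close> by (intro order_tendstoD) auto
      then obtain n where n: "measure M (C n) > measure M S - e"
        by (auto simp: eventually_sequentially)
      have "C n \<subseteq> S" using \<open>(\<Union>n. C n) = S\<close> by blast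
      then have "measure M (S - C n) < e"
        using n C_closed borel_sets \<open>open S\<close> by (subst finite_measure_Diff) auto
      then show ?thesis
        using \<open>C n \<subseteq> S\<close> C_closed \<open>open S\<close> by blast
    qed
  next
    case Empty
    then show ?case by (intro exI[of _ "{}"]) auto
  next
    case (Compl S)
    obtain C U where CU: "closed C" "open U" "C \<subseteq> S" "S \<subseteq> U" "measure M (U - C) < e"
      using Compl.IH[OF Compl.prems] by (elim exE conjE)
    have "- C - (- U) = U - C" by blast
    then have "measure M (- C - (- U)) < e" using CU(5) by metis
    moreover have "closed (- U)" "open (- C)" using CU(1,2) by auto
    moreover have "- U \<subseteq> UNIV - S" "UNIV - S \<subseteq> - C" using CU(3,4) by blast+
    ultimately show ?case by blast
  next
    case (Union S)
    \<comment> \<open>The errors add up to \<open>e / 2\<close>. The other half is room for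
      replacing the union of all \<open>C n\<close>, which need not be closed, by a finite
      union.\<close>
    define d where "d n = e / 2 * (1 / 2) ^ Suc n" for n :: nat
    have d: "d n > 0" for n using Union by (simp add: d_def)
    have d_sums: "d sums (e / 2)"
      unfolding d_def using sums_mult[OF power_half_series, of "e / 2"] by simp
    have "\<exists>C U. closed C \<and> open U \<and> C \<subseteq> S n \<and> S n \<subseteq> U \<and> measure M (U - C) < d n" for n
      by (rule Union.IH) (rule d)
    then obtain C U where CU: "\<And>n. closed (C n)" "\<And>n. open (U n)" "\<And>n. C n \<subseteq> S n"
      "\<And>n. S n \<subseteq> U n" "\<And>n. measure M (U n - C n) < d n"
      by metis
    have sets [measurable]: "C n \<in> sets M" "U n \<in> sets M" for n
      using CU borel_sets by auto
    define W where "W = (\<Union>n. U n)"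
    define D where "D N = (\<Union>n\<le>N. C n)" for N
    have W_sets: "W \<in> sets M" and D_sets: "D N \<in> sets M" for N
      unfolding W_def D_def by auto
    have "measure M (W - (\<Union>n. C n)) \<le> measure M (\<Union>n. U n - C n)"
      by (intro finite_measure_mono) (auto simp: W_def)
    also have "\<dots> \<le> (\<Sum>n. measure M (U n - C n))"
    proof (rule finite_measure_subadditive_countably)
      show "summable (\<lambda>n. measure M (U n - C n))"
        by (rule summable_comparison_test'[OF sums_summable[OF d_sums]]) (use CU(5) in \<open>auto intro: less_imp_le\<close>)
    qed auto
    also have "\<dots> \<le> (\<Sum>n. d n)"
    proof (rule suminf_le)
      show "summable (\<lambda>n. measure M (U n - C n))"
        by (rule summable_comparison_test'[OF sums_summable[OF d_sums]]) (use CU(5) in \<open>auto intro: less_imp_le\<close>)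
    qed (use CU(5) d_sums in \<open>auto intro: less_imp_le sums_summable\<close>)
    also have "\<dots> = e / 2" using d_sums by (rule sums_unique[symmetric])
    finally have "measure M (W - (\<Union>n. C n)) < e" using Union.prems by simp
    moreover have "(\<lambda>N. measure M (W - D N)) \<longlonglongrightarrow> measure M (\<Inter>N. W - D N)"
    proof (rule finite_Lim_measure_decseq)
      show "decseq (\<lambda>N. W - D N)"
        unfolding decseq_def D_def by (auto intro: order_trans)
    qed (use W_sets D_sets in auto)
    moreover have "(\<Inter>N. W - D N) = W - (\<Union>n. C n)" by (auto simp: D_def)
    ultimately have "\<forall>\<^sub>F N in sequentially. measure M (W - D N) < e"
      by (intro order_tendstoD) auto
    then obtain N where "measure M (W - D N) < e" by (auto simp: eventually_sequentially)
    moreover have "closed (D N)" "open W" unfolding D_def W_def using CU by auto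
    moreover have "D N \<subseteq> (\<Union>n. S n)" "(\<Union>n. S n) \<subseteq> W" unfolding D_def W_def using CU by fast+
    ultimately show ?case by blast
  qed
qed

lemma compact_closed_separated:
  fixes S T :: "'a::metric_space set"
  assumes "compact S" "closed T" "S \<inter> T = {}"
  shows "\<exists>d>0. \<forall>x\<in>S. \<forall>y\<in>T. d \<le> dist x y"
proof (cases "S = {} \<or> T = {}")
  case False
  have "continuous_on S (\<lambda>x. infdist x T)" by (intro continuous_intros)
  then obtain x where x: "x \<in> S" "\<And>y. y \<in> S \<Longrightarrow> infdist x T \<le> infdist y T"
    using continuous_attains_inf[OF \<open>compact S\<close>] False by blast
  have "infdist x T \<noteq> 0"
    using in_closed_iff_infdist_zero[OF \<open>closed T\<close>, of x] False x(1) assms(3) by blast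
  then have "infdist x T > 0" using infdist_nonneg[of x T] by linarith
  moreover have "infdist x T \<le> dist y z" if "y \<in> S" "z \<in> T" for y z
    using x(2)[OF that(1)] infdist_le[OF that(2), of y] by linarith
  ultimately show ?thesis by blast
next
  case True
  then show ?thesis by (intro exI[of _ 1]) auto
qed

text \<open>Each of the finitely many fibres of \<open>c\<close> is approximated from inside by a
  closed set, which is compact here. Disjoint compact sets have positive distance, so close points
  of the union share their label.\<close>

lemma lusin_finite_range:
  fixes M :: "'a::metric_space measure" and c :: "'a \<Rightarrow> nat"
  assumes cpt: "compact (UNIV :: 'a set)" and fm: "finite_measure M" and M: "sets M = sets borel"
    and c [measurable]: "c \<in> measurable M (count_space UNIV)" and fin: "finite (range c)" and "e > 0"
  shows "\<exists>U\<in>sets borel. measure M (- U) < e \<and> (\<exists>r>0. \<forall>x\<in>U. \<forall>y\<in>U. dist x y < r \<longrightarrow> c x = c y)"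
proof -
  interpret finite_measure M by fact
  have space [simp]: "space M = UNIV" using sets_eq_imp_space_eq[OF M] by simp
  let ?R = "range c"
  have ne: "card ?R > 0" using fin by (simp add: card_gt_0_iff)
  have pre: "c -` {h} \<in> sets borel" for h
    using measurable_sets[OF c, of "{h}"] by (simp add: M)
  have "\<exists>C. closed C \<and> C \<subseteq> c -` {h} \<and> measure M (c -` {h} - C) < e / card ?R" for h
  proof -
    obtain C U where CU: "closed C" "open U" "C \<subseteq> c -` {h}" "c -` {h} \<subseteq> U" "measure M (U - C) < e / card ?R"
      using finite_measure_closed_open_approx[OF fm M pre, of "e / card ?R" h] \<open>e > 0\<close> ne by auto
    have "measure M (c -` {h} - C) \<le> measure M (U - C)"
      using CU by (intro finite_measure_mono) (auto simp: M)
    then show ?thesis using CU by force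
  qed
  then obtain C where C: "\<And>h. closed (C h)" "\<And>h. C h \<subseteq> c -` {h}"
    "\<And>h. measure M (c -` {h} - C h) < e / card ?R"
    by metis
  have C_cpt: "compact (C h)" for h
    using C(1) cpt by (metis compact_Int_closed inf_top_left)
  have sep: "\<exists>d>0. \<forall>x\<in>C h. \<forall>y\<in>C h'. h \<noteq> h' \<longrightarrow> d \<le> dist x y" for h h'
  proof (cases "h = h'")
    case False
    then have "C h \<inter> C h' = {}" using C(2) by blast
    from compact_closed_separated[OF C_cpt C(1) this] show ?thesis by blast
  next
    case True
    then show ?thesis by (intro exI[of _ 1]) auto
  qed
  then obtain d where d: "\<And>h h'. d h h' > 0"
    "\<And>h h' x y. x \<in> C h \<Longrightarrow> y \<in> C h' \<Longrightarrow> h \<noteq> h' \<Longrightarrow> d h h' \<le> dist x y"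
    using sep by metis
  \<comment> \<open>The diagonal contributes arbitrary positive numbers; including it keeps
    \<open>D\<close> nonempty even when \<open>c\<close> is constant.\<close>
  define D where "D = (\<lambda>(h, h'). d h h') ` (?R \<times> ?R)"
  have D: "finite D" "D \<noteq> {}" using fin by (auto simp: D_def)
  have "Min D > 0" using D d(1) by (subst Min_gr_iff) (auto simp: D_def)
  define U where "U = (\<Union>h\<in>?R. C h)"
  have "measure M (- U) \<le> measure M (\<Union>h\<in>?R. c -` {h} - C h)"
    using fin pre C(1) by (intro finite_measure_mono sets.finite_UN sets.Diff) (auto simp: U_def M)
  also have "\<dots> \<le> (\<Sum>h\<in>?R. measure M (c -` {h} - C h))"
    using fin pre C(1) by (intro finite_measure_subadditive_finite) (auto simp: M)
  also have "\<dots> < (\<Sum>h\<in>?R. e / card ?R)"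
    using fin C(3) by (intro sum_strict_mono) auto
  also have "\<dots> = e" using ne by simp
  finally have "measure M (- U) < e" .
  moreover have "U \<in> sets borel" unfolding U_def using fin C(1) by (intro sets.finite_UN) auto
  moreover have "c x = c y" if "x \<in> U" "y \<in> U" "dist x y < Min D" for x y
  proof (rule ccontr)
    assume neq: "c x \<noteq> c y"
    have "x \<in> C (c x)" "y \<in> C (c y)" using that(1,2) C(2) by (fastforce simp: U_def)+
    then have "d (c x) (c y) \<le> dist x y" using neq by (rule d(2))
    moreover have "Min D \<le> d (c x) (c y)" using D by (intro Min_le) (auto simp: D_def)
    ultimately show False using that by simp
  qed
  ultimately show ?thesis using \<open>Min D > 0\<close> by blast
qed

lemma compact_UNIV_finite_small_cover:
  assumes "compact (UNIV :: 'a::metric_space set)" and "r > 0"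
  shows "\<exists>F :: 'a set. finite F \<and> (\<forall>x. \<exists>z\<in>F. dist z x < r)"
proof -
  obtain F :: "'a set" where "finite F" "UNIV \<subseteq> (\<Union>z\<in>F. ball z r)"
    by (rule compactE_image[OF assms(1), where C=UNIV and f="\<lambda>z. ball z r"]) (use \<open>r > 0\<close> in auto)
  then show ?thesis by (intro exI[of _ F]) (auto simp: subset_iff)
qed

section \<open>Mean distances and Hamming averages\<close>

locale compact_system =
  fixes T :: "'a::metric_space \<Rightarrow> 'a" and \<mu> :: "'a measure"
  assumes compact_UNIV: "compact (UNIV :: 'a set)"
    and continuous_T: "continuous_on UNIV T"
    and sets_borel: "sets \<mu> = sets borel"
    and prob_mu: "prob_space \<mu>"
    and invariant: "distr \<mu> \<mu> T = \<mu>"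

sublocale compact_system \<subseteq> measure_preserving_system \<mu> T
proof -
  interpret prob_space \<mu> by (rule prob_mu)
  show "measure_preserving_system \<mu> T"
  proof
    have "T \<in> borel_measurable borel"
      using continuous_T by (rule borel_measurable_continuous_onI)
    then show "T \<in> measurable \<mu> \<mu>"
      using measurable_cong_sets[OF sets_borel sets_borel] by blast
  qed (rule invariant)
qed

context compact_system
begin

lemma space_mu [simp]: "space \<mu> = UNIV"
  using sets_eq_imp_space_eq[OF sets_borel] by simp

lemma continuous_funpow: "continuous_on UNIV (T ^^ i)"
proof (induction i)
  case (Suc i)
  have "continuous_on ((T ^^ i) ` UNIV) T"
    using continuous_T by (rule continuous_on_subset) simp
  from continuous_on_compose[OF Suc this] show ?case by simp
qed (simp add: id_def)

lemma mean_dist_measurable [measurable]: "mean_dist T n x \<in> borel_measurable \<mu>"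
proof -
  have "continuous_on UNIV (mean_dist T n x)"
    unfolding mean_dist_def divide_inverse by (intro continuous_intros continuous_funpow)
  then have "mean_dist T n x \<in> borel_measurable borel"
    by (rule borel_measurable_continuous_onI)
  then show ?thesis
    using measurable_cong_sets[OF sets_borel refl] by blast
qed

lemma mean_dist_commute: "mean_dist T n x y = mean_dist T n y x"
  by (simp add: mean_dist_def dist_commute)

lemma mean_dist_triangle: "mean_dist T n x z \<le> mean_dist T n x y + mean_dist T n y z"
proof -
  have "(\<Sum>i<n. dist ((T ^^ i) x) ((T ^^ i) z))
      \<le> (\<Sum>i<n. dist ((T ^^ i) x) ((T ^^ i) y) + dist ((T ^^ i) y) ((T ^^ i) z))"
    by (intro sum_mono dist_triangle)
  then show ?thesis
    by (simp add: mean_dist_def sum.distrib divide_right_mono flip: add_divide_distrib)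
qed

text \<open>Finitely many iterates are uniformly continuous with a common modulus. This handles the
  times before a threshold \<open>N\<close>.\<close>

lemma mean_dist_uniformly_small:
  assumes "e > 0"
  shows "\<exists>r>0. \<forall>n<N. \<forall>x y. dist x y < r \<longrightarrow> mean_dist T n x y < e"
proof -
  have "\<exists>r>0. \<forall>x y. dist x y < r \<longrightarrow> dist ((T ^^ i) x) ((T ^^ i) y) < e / 2" for i
    using compact_uniformly_continuous[OF continuous_funpow compact_UNIV, of i] assms
    unfolding uniformly_continuous_on_def by (metis UNIV_I dist_commute half_gt_zero)
  then obtain r where r: "\<And>i. r i > 0"
    "\<And>i x y. dist x y < r i \<Longrightarrow> dist ((T ^^ i) x) ((T ^^ i) y) < e / 2" by metis
  define R where "R = Min (insert 1 (r ` {..<N}))"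
  have "R > 0" using r(1) by (auto simp: R_def)
  moreover have "mean_dist T n x y < e" if n: "n < N" and d: "dist x y < R" for n x y
  proof -
    have "(\<Sum>i<n. dist ((T ^^ i) x) ((T ^^ i) y)) \<le> (\<Sum>i<n. e / 2)"
    proof (rule sum_mono)
      fix i assume "i \<in> {..<n}"
      then have "R \<le> r i" unfolding R_def using n by (intro Min_le) auto
      then show "dist ((T ^^ i) x) ((T ^^ i) y) \<le> e / 2" using d r(2)[of x y i] by simp
    qed
    then have "mean_dist T n x y \<le> (n * (e / 2)) / n"
      unfolding mean_dist_def by (intro divide_right_mono) auto
    also have "\<dots> < e" using assms by (cases "n = 0") auto
    finally show ?thesis .
  qed
  ultimately show ?thesis by blast
qed

section \<open>Equicontinuity in the mean versus mean equicontinuity\<close>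

lemma mean_equicontinuous_if_in_mean:
  assumes "mu_equicontinuous_in_mean \<mu> T"
  shows "mu_mean_equicontinuous \<mu> T"
proof -
  have "mean_equicontinuous_set T K" if K: "equicontinuous_set_in_mean T K" for K
    unfolding mean_equicontinuous_set_def
  proof (intro allI impI)
    fix e :: real assume "e > 0"
    then obtain d where d: "d > 0"
      "\<And>n x y. n \<ge> 1 \<Longrightarrow> x \<in> K \<Longrightarrow> y \<in> K \<Longrightarrow> dist x y < d \<Longrightarrow> mean_dist T n x y < e / 2"
      using K unfolding equicontinuous_set_in_mean_def by (metis half_gt_zero)
    have "limsup (\<lambda>n. ereal (mean_dist T n x y)) < ereal e" if "x \<in> K" "y \<in> K" "dist x y < d" for x y
    proof -
      have "\<forall>\<^sub>F n in sequentially. ereal (mean_dist T n x y) \<le> ereal (e / 2)"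
        using eventually_ge_at_top[of 1]
        by eventually_elim (use d(2) that in \<open>auto intro: less_imp_le\<close>)
      \<comment> \<open>The upper limit preserves only weak inequalities, hence the choice of
        \<open>e / 2\<close>.\<close>
      then have "limsup (\<lambda>n. ereal (mean_dist T n x y)) \<le> ereal (e / 2)"
        by (rule Limsup_bounded)
      also have "\<dots> < ereal e" using \<open>e > 0\<close> by simp
      finally show ?thesis .
    qed
    then show "\<exists>d>0. \<forall>x\<in>K. \<forall>y\<in>K. dist x y < d \<longrightarrow> limsup (\<lambda>n. ereal (mean_dist T n x y)) < ereal e"
      using d(1) by blast
  qed
  then show ?thesis
    using assms unfolding mu_mean_equicontinuous_def mu_equicontinuous_in_mean_def by meson
qed

text \<open>Equicontinuity in the mean at a single scale: here the set \<open>U\<close> may depend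
  on \<open>e\<close>.\<close>

definition mean_small_off :: "real \<Rightarrow> real \<Rightarrow> bool" where
  "mean_small_off e \<tau> \<longleftrightarrow> (\<exists>U\<in>sets borel. prob U > 1 - \<tau> \<and>
     (\<exists>r>0. \<forall>n\<ge>1. \<forall>x\<in>U. \<forall>y\<in>U. dist x y < r \<longrightarrow> mean_dist T n x y < e))"

text \<open>Intersecting the sets for the scales \<open>1 / Suc m\<close> gives one set for all
  \<open>e\<close>; the allowed losses \<open>t m\<close> add up to
  \<open>\<tau> / 2\<close>.\<close>

lemma equicontinuous_in_mean_if_mean_small_off:
  assumes "\<And>e \<tau>. e > 0 \<Longrightarrow> \<tau> > 0 \<Longrightarrow> mean_small_off e \<tau>"
  shows "mu_equicontinuous_in_mean \<mu> T"
  unfolding mu_equicontinuous_in_mean_def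
proof (intro allI impI)
  fix \<tau> :: real assume "\<tau> > 0"
  define t where "t m = \<tau> / 2 * (1 / 2) ^ Suc m" for m :: nat
  have t: "t m > 0" for m using \<open>\<tau> > 0\<close> by (simp add: t_def)
  have t_sums: "t sums (\<tau> / 2)"
    unfolding t_def using sums_mult[OF power_half_series, of "\<tau> / 2"] by simp
  have "mean_small_off (1 / Suc m) (t m)" for m
    using t by (intro assms) auto
  then have "\<exists>U r. U \<in> sets borel \<and> prob U > 1 - t m \<and> r > 0 \<and>
      (\<forall>n\<ge>1. \<forall>x\<in>U. \<forall>y\<in>U. dist x y < r \<longrightarrow> mean_dist T n x y < 1 / Suc m)" for m
    unfolding mean_small_off_def by meson
  then obtain U r where U: "\<And>m. U m \<in> sets borel" "\<And>m. prob (U m) > 1 - t m" "\<And>m. r m > 0"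
    "\<And>m n x y. n \<ge> 1 \<Longrightarrow> x \<in> U m \<Longrightarrow> y \<in> U m \<Longrightarrow> dist x y < r m \<Longrightarrow> mean_dist T n x y < 1 / Suc m"
    by metis
  have [measurable]: "U m \<in> sets \<mu>" for m using U(1) sets_borel by simp
  have compl: "prob (- U m) \<le> t m" for m
    using prob_compl[of "U m"] U(2)[of m] by (simp add: Compl_eq_Diff_UNIV)
  define K where "K = (\<Inter>m. U m)"
  have K_sets: "K \<in> sets borel" unfolding K_def using U(1) by auto
  have summ: "summable (\<lambda>m. prob (- U m))"
    by (rule summable_comparison_test'[OF sums_summable[OF t_sums]]) (use compl in auto)
  have "prob (- K) = prob (\<Union>m. - U m)" by (simp add: K_def)
  also have "\<dots> \<le> (\<Sum>m. prob (- U m))"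
    using summ U(1) by (intro finite_measure_subadditive_countably) (auto simp: sets_borel borel_comp)
  also have "\<dots> \<le> (\<Sum>m. t m)"
    using compl summ t_sums by (intro suminf_le) (auto intro: sums_summable)
  also have "\<dots> = \<tau> / 2" using t_sums by (rule sums_unique[symmetric])
  finally have "prob K > 1 - \<tau>"
    using prob_compl[of K] K_sets \<open>\<tau> > 0\<close> by (simp add: Compl_eq_Diff_UNIV sets_borel)
  moreover have "equicontinuous_set_in_mean T K"
    unfolding equicontinuous_set_in_mean_def
  proof (intro allI impI)
    fix e :: real assume "e > 0"
    then obtain m where m: "1 / real (Suc m) < e" using nat_approx_posE by blast
    have "mean_dist T n x y < e" if "n \<ge> 1" "x \<in> K" "y \<in> K" "dist x y < r m" for n x y
      using U(4)[of n x m y] that m by (force simp: K_def)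
    then show "\<exists>d>0. \<forall>n\<ge>1. \<forall>x\<in>K. \<forall>y\<in>K. dist x y < d \<longrightarrow> mean_dist T n x y < e"
      using U(3) by blast
  qed
  ultimately show "\<exists>K\<in>sets borel. equicontinuous_set_in_mean T K \<and> 1 - \<tau> < prob K"
    using K_sets by blast
qed

text \<open>Comparison with a finite net \<open>F\<close> in \<open>K\<close> reduces pairs to
  single points. Since \<open>F\<close> is finite, each point of \<open>K\<close> has one time after
  which its averages to all nearby net points are below \<open>e / 2\<close>, and few points need
  long.\<close>

lemma mean_small_off_if_mean_equicontinuous:
  assumes "mu_mean_equicontinuous \<mu> T" and "e > 0" "\<tau> > 0"
  shows "mean_small_off e \<tau>"
proof -
  obtain K where K: "K \<in> sets borel" "mean_equicontinuous_set T K" "prob K > 1 - \<tau>"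
    using assms unfolding mu_mean_equicontinuous_def by blast
  obtain d where d: "d > 0"
    "\<And>x y. x \<in> K \<Longrightarrow> y \<in> K \<Longrightarrow> dist x y < d \<Longrightarrow> limsup (\<lambda>n. ereal (mean_dist T n x y)) < ereal (e / 2)"
    using K(2) \<open>e > 0\<close> unfolding mean_equicontinuous_set_def by (metis half_gt_zero)
  \<comment> \<open>The net of the whole space need not lie in \<open>K\<close>. Moving its centres
    into \<open>K\<close> costs a factor of two, giving a \<open>d / 2\<close>-net; the remaining
    \<open>d / 2\<close> is for the distance from \<open>x\<close> to \<open>y\<close>.\<close>
  have "d / 4 > 0" using d(1) by simp
  from compact_UNIV_finite_small_cover[OF compact_UNIV this]
  obtain Z :: "'a set" where Z: "finite Z" "\<And>x. \<exists>z\<in>Z. dist z x < d / 4" by blast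
  define p where "p z = (SOME x. x \<in> K \<and> dist z x < d / 4)" for z
  define F where "F = p ` {z\<in>Z. \<exists>x. x \<in> K \<and> dist z x < d / 4}"
  have p: "p z \<in> K \<and> dist z (p z) < d / 4" if "x \<in> K" "dist z x < d / 4" for x z
    unfolding p_def using that by (intro someI[of "\<lambda>x. x \<in> K \<and> dist z x < d / 4" x]) auto
  have F: "finite F" "F \<subseteq> K" using Z(1) p by (auto simp: F_def)
  have near: "\<exists>f\<in>F. dist f x < d / 2" if x: "x \<in> K" for x
  proof -
    obtain z where z: "z \<in> Z" "dist z x < d / 4" using Z(2) by blast
    have "dist (p z) x \<le> dist z (p z) + dist z x" by (metis dist_commute dist_triangle)
    then have "dist (p z) x < d / 2" using p[OF x z(2)] z(2) by simp
    then show ?thesis using z x by (auto simp: F_def)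
  qed
  define V where "V N = {y \<in> K. \<forall>f\<in>F. dist f y < d \<longrightarrow> (\<forall>n\<ge>N. mean_dist T n f y < e / 2)}" for N :: nat
  have [measurable]: "K \<in> sets \<mu>" using K(1) by (simp add: sets_borel)
  have [measurable]: "dist f \<in> borel_measurable \<mu>" for f
  proof -
    have "continuous_on UNIV (dist f)" by (intro continuous_intros)
    then show ?thesis
      using measurable_cong_sets[OF sets_borel refl] borel_measurable_continuous_onI by blast
  qed
  have V_sets [measurable]: "V N \<in> sets \<mu>" for N
  proof -
    have "{y \<in> space \<mu>. y \<in> K \<and> (\<forall>f\<in>F. dist f y < d \<longrightarrow> (\<forall>n\<in>{N..}. mean_dist T n f y < e / 2))} \<in> sets \<mu>"
      using F(1) by measurable
    also have "{y \<in> space \<mu>. y \<in> K \<and> (\<forall>f\<in>F. dist f y < d \<longrightarrow> (\<forall>n\<in>{N..}. mean_dist T n f y < e / 2))} = V N"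
      by (auto simp: V_def)
    finally show ?thesis .
  qed
  have "(\<lambda>N. prob (V N)) \<longlonglongrightarrow> prob (\<Union>N. V N)"
  proof (rule finite_Lim_measure_incseq)
    show "incseq V"
      unfolding incseq_def V_def by auto
  qed auto
  also have "(\<Union>N. V N) = K"
  proof (intro equalityI subsetI)
    fix y assume y: "y \<in> K"
    have "\<exists>N. \<forall>n\<ge>N. dist f y < d \<longrightarrow> mean_dist T n f y < e / 2" if f: "f \<in> F" for f
    proof (cases "dist f y < d")
      case True
      then have "limsup (\<lambda>n. ereal (mean_dist T n f y)) < ereal (e / 2)"
        using d(2) f F(2) y by blast
      then have "\<forall>\<^sub>F n in sequentially. ereal (mean_dist T n f y) < ereal (e / 2)"
        by (rule Limsup_lessD)
      then have "\<exists>N. \<forall>n\<ge>N. mean_dist T n f y < e / 2"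
        by (simp add: eventually_sequentially)
      then show ?thesis by blast
    qed auto
    then obtain N where N: "\<And>f n. f \<in> F \<Longrightarrow> n \<ge> N f \<Longrightarrow> dist f y < d \<Longrightarrow> mean_dist T n f y < e / 2"
      by metis
    have "N f \<le> Max (N ` F)" if "f \<in> F" for f using F(1) that by simp
    then have "y \<in> V (Max (N ` F))"
      using y N by (auto simp: V_def intro: order_trans)
    then show "y \<in> (\<Union>N. V N)" by blast
  qed (auto simp: V_def)
  finally have "\<forall>\<^sub>F N in sequentially. prob (V N) > 1 - \<tau>"
    using K(3) by (intro order_tendstoD)
  then obtain N where N: "prob (V N) > 1 - \<tau>" by (auto simp: eventually_sequentially)
  obtain r where r: "r > 0" "\<And>n x y. n < N \<Longrightarrow> dist x y < r \<Longrightarrow> mean_dist T n x y < e"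
    using mean_dist_uniformly_small[OF \<open>e > 0\<close>, of N] by blast
  have "mean_dist T n x y < e" if xy: "x \<in> V N" "y \<in> V N" "dist x y < min r (d / 2)" for n x y
  proof (cases "n < N")
    case False
    have "x \<in> K" using xy by (simp add: V_def)
    then obtain f where f: "f \<in> F" "dist f x < d / 2" using near by blast
    have "dist f y \<le> dist f x + dist x y" by (rule dist_triangle)
    then have "dist f y < d" "dist f x < d" using f xy zero_le_dist[of f x] d(1) by linarith+
    then have "mean_dist T n f x < e / 2" "mean_dist T n f y < e / 2"
      using xy f False by (auto simp: V_def)
    then show ?thesis using mean_dist_triangle[of n x y f] by (simp add: mean_dist_commute[of n x])
  qed (use xy r in auto)
  then show ?thesis
    unfolding mean_small_off_def using N V_sets[of N] r(1) d(1)
    by (intro bexI[of _ "V N"] conjI exI[of _ "min r (d / 2)"]) (auto simp: sets_borel)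
qed

section \<open>Passing between mean distances and Hamming averages\<close>

lemma labelled:
  assumes "c \<in> measurable \<mu> (count_space UNIV)"
  shows "labelled_system \<mu> T c"
  by unfold_locales (use assms in auto)

text \<open>The Hamming distance is split into the visits to the complement of a Lusin set, which are
  rare on average by invariance of the measure, and the times at which the orbits are far apart.\<close>

lemma spanned_if_equicontinuous_in_mean:
  assumes eq: "mu_equicontinuous_in_mean \<mu> T" and c: "c \<in> measurable \<mu> (count_space UNIV)"
    and fin: "finite (range c)" and "e > 0"
  shows "\<exists>k>0. \<forall>n\<ge>1. labelled_system.spanned \<mu> T c k n e"
proof -
  interpret labelled_system \<mu> T c using c by (rule labelled)
  \<comment> \<open>Markov's inequality at threshold \<open>e / 4\<close> turns the mass
    \<open>e\<^sup>2 / 16\<close> into an exceptional set of measure at most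
    \<open>e / 4\<close>.\<close>
  have "\<exists>U\<in>sets borel. prob (- U) < e\<^sup>2 / 16 \<and> (\<exists>r>0. \<forall>x\<in>U. \<forall>y\<in>U. dist x y < r \<longrightarrow> c x = c y)"
    using \<open>e > 0\<close> by (intro lusin_finite_range compact_UNIV sets_borel c fin finite_measure_axioms) auto
  then obtain U r where U: "U \<in> sets borel" "prob (- U) < e\<^sup>2 / 16" "r > 0"
    "\<And>x y. x \<in> U \<Longrightarrow> y \<in> U \<Longrightarrow> dist x y < r \<Longrightarrow> c x = c y" by blast
  have [measurable]: "U \<in> sets \<mu>" using U(1) by (simp add: sets_borel)
  define u where "u x = (indicator (- U) x :: real)" for x
  have u_meas [measurable]: "u \<in> borel_measurable \<mu>"
    unfolding u_def by (intro borel_measurable_indicator) (use U(1) sets_borel in auto)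
  have u_nonneg: "0 \<le> u x" and u_bound: "\<bar>u x\<bar> \<le> 1" for x by (auto simp: u_def indicator_def)
  \<comment> \<open>At a time when both orbits are in \<open>U\<close> and the labels differ, the
    points are at least \<open>r\<close> apart, so \<open>dist / r\<close> is at least
    \<open>1\<close>.\<close>
  have ham_le: "ham n x y \<le> bsum u n x / n + bsum u n y / n + mean_dist T n x y / r" for n x y
  proof -
    have "of_bool (c a \<noteq> c b) \<le> u a + u b + dist a b / r" for a b
    proof (cases "a \<in> U \<and> b \<in> U \<and> c a \<noteq> c b")
      case True
      then have "r \<le> dist a b" using U(4)[of a b] by (auto simp: not_less[symmetric])
      then have "1 \<le> dist a b / r" using U(3) by simp
      then show ?thesis using u_nonneg[of a] u_nonneg[of b] by (simp add: of_bool_def)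
    next
      case False
      then show ?thesis using U(3) by (auto simp: u_def indicator_def)
    qed
    then have "(\<Sum>i<n. of_bool (c ((T ^^ i) x) \<noteq> c ((T ^^ i) y)))
        \<le> (\<Sum>i<n. u ((T ^^ i) x) + u ((T ^^ i) y) + dist ((T ^^ i) x) ((T ^^ i) y) / r)"
      by (intro sum_mono)
    also have "\<dots> = bsum u n x + bsum u n y + (\<Sum>i<n. dist ((T ^^ i) x) ((T ^^ i) y)) / r"
      by (simp add: sum.distrib bsum_def sum_divide_distrib)
    finally have "ham n x y \<le> (bsum u n x + bsum u n y + (\<Sum>i<n. dist ((T ^^ i) x) ((T ^^ i) y)) / r) / n"
      unfolding ham_eq_sum by (intro divide_right_mono) auto
    then show ?thesis by (simp add: mean_dist_def add_divide_distrib mult.commute)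
  qed
  have rare: "prob {x. bsum u n x / n \<ge> e / 4} \<le> e / 4" if "n \<ge> 1" for n
  proof -
    have int_pow: "integrable \<mu> (\<lambda>x. u ((T ^^ i) x))" for i
      by (rule integrable_const_bound[of _ 1]) (use u_bound in auto)
    have "(\<integral>x. bsum u n x / n \<partial>\<mu>) = (\<Sum>i<n. (\<integral>x. u ((T ^^ i) x) \<partial>\<mu>)) / n"
      unfolding bsum_def using int_pow by simp
    also have "\<dots> = (\<integral>x. u x \<partial>\<mu>)"
      using that by (simp add: integral_funpow)
    also have "\<dots> = prob (- U)"
      unfolding u_def by simp
    finally have int: "(\<integral>x. bsum u n x / n \<partial>\<mu>) \<le> e\<^sup>2 / 16" using U(2) by simp
    have "prob {x \<in> space \<mu>. bsum u n x / n \<ge> e / 4} \<le> (\<integral>x. bsum u n x / n \<partial>\<mu>) / (e / 4)"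
    proof (rule integral_Markov_inequality_measure[where A="{}"])
      show "integrable \<mu> (\<lambda>x. bsum u n x / n)"
        unfolding bsum_def using int_pow
        by (intro Bochner_Integration.integrable_divide Bochner_Integration.integrable_sum) auto
      show "AE x in \<mu>. 0 \<le> bsum u n x / n"
        using u_nonneg by (auto simp: bsum_def intro!: divide_nonneg_nonneg sum_nonneg)
    qed (use \<open>e > 0\<close> in auto)
    also have "\<dots> \<le> (e\<^sup>2 / 16) / (e / 4)"
      using int \<open>e > 0\<close> by (intro divide_right_mono) auto
    also have "\<dots> = e / 4" using \<open>e > 0\<close> by (simp add: power2_eq_square)
    finally show ?thesis by simp
  qed
  obtain K where K: "K \<in> sets borel" "equicontinuous_set_in_mean T K" "prob K > 1 - e / 4"
    using eq \<open>e > 0\<close> unfolding mu_equicontinuous_in_mean_def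
    by (metis divide_pos_pos zero_less_numeral)
  have K_sets [measurable]: "K \<in> sets \<mu>" using K(1) by (simp add: sets_borel)
  \<comment> \<open>After division by \<open>r\<close> this is the third summand
    \<open>e / 4\<close> in \<open>ham_le\<close>.\<close>
  have "e * r / 4 > 0" using U(3) \<open>e > 0\<close> by simp
  then obtain d where d: "d > 0"
    "\<And>n x y. n \<ge> 1 \<Longrightarrow> x \<in> K \<Longrightarrow> y \<in> K \<Longrightarrow> dist x y < d \<Longrightarrow> mean_dist T n x y < e * r / 4"
    using K(2) unfolding equicontinuous_set_in_mean_def by meson
  have "d / 2 > 0" using d(1) by simp
  from compact_UNIV_finite_small_cover[OF compact_UNIV this]
  obtain Z :: "'a set" where Z: "finite Z" "\<And>x. \<exists>z\<in>Z. dist z x < d / 2" by blast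
  have "card Z > 0" using Z by (auto simp: card_gt_0_iff)
  moreover have "spanned (card Z) n e" if n: "n \<ge> 1" for n
  proof -
    define G where "G = K \<inter> {x. bsum u n x / n < e / 4}"
    have G_sets [measurable]: "{x. bsum u n x / n < e / 4} \<in> sets \<mu>"
    proof -
      have "{x \<in> space \<mu>. bsum u n x / n < e / 4} \<in> sets \<mu>" by measurable
      then show ?thesis by simp
    qed
    have "prob (- G) \<le> prob (- K) + prob {x. bsum u n x / n \<ge> e / 4}"
    proof -
      have "- G = (space \<mu> - K) \<union> (space \<mu> - {x. bsum u n x / n < e / 4})" by (auto simp: G_def)
      also have "prob \<dots> \<le> prob (space \<mu> - K) + prob (space \<mu> - {x. bsum u n x / n < e / 4})"
        by (intro measure_Un_le sets.compl_sets G_sets K_sets)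
      finally show ?thesis by (simp add: Compl_eq_Diff_UNIV set_diff_eq not_less)
    qed
    moreover have "prob (- K) < e / 4" using prob_compl[of K] K(3) by (simp add: Compl_eq_Diff_UNIV)
    ultimately have "prob (- G) < e" using rare[OF n] \<open>e > 0\<close> by linarith
    then have G: "prob G > 1 - e"
      using prob_compl[of G] by (simp add: Compl_eq_Diff_UNIV G_def)
    \<comment> \<open>The good set \<open>G\<close> and hence the centres depend on
      \<open>n\<close>, but their number is at most \<open>card Z\<close>, chosen before
      \<open>n\<close>.\<close>
    define p where "p z = (SOME x. x \<in> G \<and> dist z x < d / 2)" for z
    have p: "p z \<in> G \<and> dist z (p z) < d / 2" if "x \<in> G" "dist z x < d / 2" for x z
      unfolding p_def using that by (intro someI[of "\<lambda>x. x \<in> G \<and> dist z x < d / 2" x]) auto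
    have "G \<subseteq> (\<Union>x\<in>p ` Z. {y. ham n x y < e})"
    proof
      fix y assume y: "y \<in> G"
      obtain z where z: "z \<in> Z" "dist z y < d / 2" using Z(2) by blast
      note pz = p[OF y z(2)]
      have "dist (p z) y \<le> dist z (p z) + dist z y" by (metis dist_commute dist_triangle)
      then have "dist (p z) y < d" using pz z by simp
      then have "mean_dist T n (p z) y < e * r / 4"
        using d(2)[OF n] pz y by (auto simp: G_def)
      then have "mean_dist T n (p z) y / r < e / 4" using U(3) by (simp add: field_simps)
      moreover have "bsum u n (p z) / n < e / 4" "bsum u n y / n < e / 4"
        using pz y by (auto simp: G_def)
      ultimately have "ham n (p z) y < e" using ham_le[of n "p z" y] \<open>e > 0\<close> by linarith
      then show "y \<in> (\<Union>x\<in>p ` Z. {y. ham n x y < e})" using z by blast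
    qed
    then have "prob G \<le> prob (\<Union>x\<in>p ` Z. {y. ham n x y < e})"
      using Z(1) by (intro finite_measure_mono sets.finite_UN) auto
    then show ?thesis
      unfolding spanned_def using G Z(1) by (intro exI[of _ "p ` Z"]) (auto simp: card_image_le)
  qed
  ultimately show ?thesis by blast
qed

text \<open>Times with equal labels contribute at most \<open>s\<close> each, all others at most the
  diameter bound \<open>D\<close>.\<close>

lemma mean_dist_le_ham:
  fixes x y :: 'a
  assumes c: "c \<in> measurable \<mu> (count_space UNIV)" and "D \<ge> 0" "s \<ge> 0"
    and diam: "\<And>x y :: 'a. dist x y \<le> D" and small: "\<And>x y. c x = c y \<Longrightarrow> dist x y \<le> s"
  shows "mean_dist T n x y \<le> s + D * labelled_system.ham T c n x y"
proof -
  interpret labelled_system \<mu> T c using c by (rule labelled)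
  have "dist a b \<le> s + D * of_bool (c a \<noteq> c b)" for a b
    using diam[of a b] small[of a b] \<open>s \<ge> 0\<close> by (auto simp: of_bool_def)
  then have "(\<Sum>i<n. dist ((T ^^ i) x) ((T ^^ i) y))
      \<le> (\<Sum>i<n. s + D * of_bool (c ((T ^^ i) x) \<noteq> c ((T ^^ i) y)))"
    by (intro sum_mono)
  also have "\<dots> = n * s + D * (\<Sum>i<n. of_bool (c ((T ^^ i) x) \<noteq> c ((T ^^ i) y)))"
    by (simp only: sum.distrib sum_constant card_lessThan sum_distrib_left)
  finally have "mean_dist T n x y \<le> (n * s + D * (\<Sum>i<n. of_bool (c ((T ^^ i) x) \<noteq> c ((T ^^ i) y)))) / n"
    unfolding mean_dist_def by (intro divide_right_mono) auto
  also have "\<dots> \<le> s + D * ham n x y"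
    using \<open>s \<ge> 0\<close> by (cases "n = 0") (auto simp: ham_eq_sum add_divide_distrib)
  finally show ?thesis .
qed

text \<open>The index of the covering set containing a point is itself a finitely valued Borel
  label. On a Lusin set for it, close points lie in the same covering set, and
  \<open>mean_dist_le_ham\<close> gives at most \<open>s + D * t \<le> 2 * s\<close>. The losses are
  \<open>t\<close> for the Lusin set and \<open>t\<close> for the uncovered points.\<close>

lemma mean_small_off_if_ham_coverable:
  assumes c: "c \<in> measurable \<mu> (count_space UNIV)" and "s > 0" "D > 0"
    and diam: "\<And>x y :: 'a. dist x y \<le> D" and small: "\<And>x y. c x = c y \<Longrightarrow> dist x y \<le> s"
    and cov: "labelled_system.ham_coverable \<mu> T c t" and t: "D * t \<le> s" "2 * t \<le> \<tau>" and "t > 0"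
  shows "mean_small_off (3 * s) \<tau>"
proof -
  interpret labelled_system \<mu> T c using c by (rule labelled)
  obtain \<B> where \<B>: "finite \<B>" "\<B> \<subseteq> sets \<mu>" "prob (\<Union>\<B>) > 1 - t"
    and \<B>_ham: "\<forall>B\<in>\<B>. \<forall>x\<in>B. \<forall>y\<in>B. \<forall>n\<ge>1. ham n x y < t"
    using cov unfolding ham_coverable_def by (elim exE conjE)
  obtain b and k :: nat where b: "\<B> = b ` {..<k}"
    using \<B>(1) unfolding finite_conv_nat_seg_image lessThan_def by blast
  have b_sets [measurable]: "b i \<in> sets \<mu>" if "i < k" for i using that \<B>(2) b by blast
  \<comment> \<open>Taking the first index makes overlapping covering sets harmless; the extra value
    \<open>k\<close> marks uncovered points.\<close>
  define a where "a x = (if x \<in> \<Union>\<B> then LEAST i. i < k \<and> x \<in> b i else k)" for x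
  have a: "a x < k \<and> x \<in> b (a x)" if "x \<in> \<Union>\<B>" for x
  proof -
    have "\<exists>i. i < k \<and> x \<in> b i" using that b by auto
    from LeastI_ex[OF this] show ?thesis using that by (simp add: a_def)
  qed
  have a_le: "a x \<le> k" for x 
  proof (cases "x \<in> \<Union>\<B>")
    case True
    then show ?thesis using a by (simp add: less_imp_le)
  next
    case False
    then have "a x = k" unfolding a_def by (rule if_not_P)
    then show ?thesis by simp
  qed
  have a_fin: "finite (range a)" using a_le by (auto intro!: finite_subset[OF _ finite_atMost[of k]])
  have a_meas: "a \<in> measurable \<mu> (count_space UNIV)"
  proof -
    \<comment> \<open>Padding with empty sets makes every index measurable, so that measurability of
      \<open>LEAST\<close> over all naturals applies.\<close>
    define b' where "b' i = (if i < k then b i else {})" for i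
    have [measurable]: "b' i \<in> sets \<mu>" for i by (simp add: b'_def)
    have "a x = (if \<exists>i. x \<in> b' i then LEAST i. x \<in> b' i else k)" for x
    proof -
      have "x \<in> \<Union>\<B> \<longleftrightarrow> (\<exists>i. x \<in> b' i)" unfolding b b'_def by auto
      moreover have "(\<lambda>i. i < k \<and> x \<in> b i) = (\<lambda>i. x \<in> b' i)" by (auto simp: b'_def)
      ultimately show ?thesis unfolding a_def by presburger
    qed
    then have "a = (\<lambda>x. if \<exists>i. x \<in> b' i then LEAST i. x \<in> b' i else k)" by (rule ext)
    also have "\<dots> \<in> measurable \<mu> (count_space UNIV)" by measurable
    finally show ?thesis .
  qed
  have "\<exists>U\<in>sets borel. prob (- U) < t \<and> (\<exists>r>0. \<forall>x\<in>U. \<forall>y\<in>U. dist x y < r \<longrightarrow> a x = a y)"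
    using \<open>t > 0\<close> by (intro lusin_finite_range compact_UNIV sets_borel a_meas a_fin finite_measure_axioms) auto
  then obtain U r where U: "U \<in> sets borel" "prob (- U) < t" "r > 0"
    "\<And>x y. x \<in> U \<Longrightarrow> y \<in> U \<Longrightarrow> dist x y < r \<Longrightarrow> a x = a y" by blast
  have U_sets [measurable]: "U \<in> sets \<mu>" using U(1) by (simp add: sets_borel)
  have cov_sets [measurable]: "\<Union>\<B> \<in> sets \<mu>" using \<B> by (intro sets.finite_Union)
  have "prob (- (U \<inter> \<Union>\<B>)) \<le> prob (- U) + prob (- \<Union>\<B>)"
  proof -
    have "- (U \<inter> \<Union>\<B>) = (space \<mu> - U) \<union> (space \<mu> - \<Union>\<B>)" by auto
    also have "prob \<dots> \<le> prob (space \<mu> - U) + prob (space \<mu> - \<Union>\<B>)"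
      by (intro measure_Un_le sets.compl_sets U_sets cov_sets)
    finally show ?thesis by (simp add: Compl_eq_Diff_UNIV)
  qed
  moreover have "prob (- \<Union>\<B>) < t"
    using prob_compl[OF cov_sets] \<B>(3) by (simp add: Compl_eq_Diff_UNIV)
  ultimately have "prob (- (U \<inter> \<Union>\<B>)) < \<tau>" using U(2) t by linarith
  then have "prob (U \<inter> \<Union>\<B>) > 1 - \<tau>"
    using prob_compl[of "U \<inter> \<Union>\<B>"] by (simp add: Compl_eq_Diff_UNIV)
  moreover have "mean_dist T n x y < 3 * s"
    if xy: "n \<ge> 1" "x \<in> U \<inter> \<Union>\<B>" "y \<in> U \<inter> \<Union>\<B>" "dist x y < r" for n x y
  proof -
    have "a x = a y" using U(4) xy by blast
    then have "x \<in> b (a x)" "y \<in> b (a x)" "b (a x) \<in> \<B>" using a[of x] a[of y] xy b by auto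
    then have "ham n x y < t" using \<B>_ham xy(1) by blast
    then have "D * ham n x y \<le> D * t" using \<open>D > 0\<close> by simp
    moreover have "mean_dist T n x y \<le> s + D * ham n x y"
      using \<open>D > 0\<close> \<open>s > 0\<close> diam small by (intro mean_dist_le_ham c) auto
    ultimately show ?thesis using t(1) \<open>s > 0\<close> by linarith
  qed
  ultimately show ?thesis
    unfolding mean_small_off_def using U(1,3) cov_sets
    by (intro bexI[of _ "U \<inter> \<Union>\<B>"] conjI exI[of _ r] allI impI ballI) (auto simp: sets_borel)
qed

end

text \<open>One point for each occurring name of length \<open>n\<close> is at Hamming distance
  \<open>0\<close> from all points with that name. This ensures that the minimum in
  \<open>spanning_number\<close> is attained.\<close>

lemma (in labelled_system) spanned_exists:
  assumes fin: "finite (range c)" and "e > 0"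
  shows "\<exists>k. spanned k n e"
proof -
  define w where "w x = restrict (\<lambda>i. c ((T ^^ i) x)) {..<n}" for x
  have "w x \<in> PiE {..<n} (\<lambda>_. range c)" for x
    unfolding w_def restrict_PiE_iff by blast
  then have "range w \<subseteq> PiE {..<n} (\<lambda>_. range c)" by blast
  then have w_fin: "finite (range w)"
    by (rule finite_subset) (use fin in \<open>auto intro: finite_PiE\<close>)
  define p where "p v = (SOME x. w x = v)" for v
  have p: "w (p (w y)) = w y" for y unfolding p_def by (rule someI[of _ y]) simp
  have "ham n (p (w y)) y = 0" for y
  proof -
    have "c ((T ^^ i) (p (w y))) = c ((T ^^ i) y)" if "i < n" for i
      using fun_cong[OF p[of y], of i] that by (simp add: w_def)
    then show ?thesis by (simp add: ham_eq_sum)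
  qed
  then have "(\<Union>x\<in>p ` range w. {y. ham n x y < e}) = space M"
    using \<open>e > 0\<close> by auto
  then have "prob (\<Union>x\<in>p ` range w. {y. ham n x y < e}) > 1 - e"
    using \<open>e > 0\<close> prob_space by simp
  then show ?thesis
    unfolding spanned_def using w_fin
    by (intro exI[of _ "card (p ` range w)"] exI[of _ "p ` range w"]) auto
qed

section \<open>Indexed partitions as labellings\<close>

definition cell_index :: "nat \<Rightarrow> (nat \<Rightarrow> 'a set) \<Rightarrow> 'a \<Rightarrow> nat" where
  "cell_index l A x = (THE h. h \<in> {1..l} \<and> x \<in> A h)"

lemma name_at_eq_cell_index: "name_at T l A i x = cell_index l A ((T ^^ i) x)"
  by (simp add: name_at_def cell_index_def)

lemma cell_index:
  assumes "measurable_partition l A"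
  shows "cell_index l A x \<in> {1..l} \<and> x \<in> A (cell_index l A x)"
proof -
  have part: "partition_on UNIV (A ` {1..l})" and inj: "inj_on A {1..l}"
    using assms by (auto simp: measurable_partition_def)
  have "\<exists>h\<in>{1..l}. x \<in> A h" using partition_onD1[OF part] by auto
  moreover have "h = h'" if "h \<in> {1..l}" "h' \<in> {1..l}" "x \<in> A h" "x \<in> A h'" for h h'
  proof -
    have "A h = A h'" using disjointD[OF partition_onD2[OF part], of "A h" "A h'"] that by auto
    then show ?thesis using inj that by (auto dest: inj_onD)
  qed
  ultimately have "\<exists>!h. h \<in> {1..l} \<and> x \<in> A h" by blast
  then show ?thesis unfolding cell_index_def by (rule theI')
qed

lemma cell_index_eq:
  assumes "measurable_partition l A" "h \<in> {1..l}" "x \<in> A h"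
  shows "cell_index l A x = h"
proof -
  have part: "partition_on UNIV (A ` {1..l})" and inj: "inj_on A {1..l}"
    using assms by (auto simp: measurable_partition_def)
  have "A (cell_index l A x) = A h"
    using disjointD[OF partition_onD2[OF part], of "A (cell_index l A x)" "A h"]
      cell_index[OF assms(1), of x] assms(2,3) by auto
  then show ?thesis using inj cell_index[OF assms(1), of x] assms(2) by (auto dest: inj_onD)
qed

lemma finite_range_cell_index:
  assumes "measurable_partition l A"
  shows "finite (range (cell_index l A))"
  using cell_index[OF assms] by (auto intro!: finite_subset[OF _ finite_atLeastAtMost[of 1 l]])

lemma cell_index_measurable:
  assumes part: "measurable_partition l A" and M: "sets M = sets borel"
  shows "cell_index l A \<in> measurable M (count_space UNIV)"
proof -
  have space: "space M = UNIV" using sets_eq_imp_space_eq[OF M] by simp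
  have "cell_index l A -` {h} \<in> sets M" for h
  proof (cases "h \<in> {1..l}")
    case True
    then have "cell_index l A -` {h} = A h"
      using cell_index[OF part] cell_index_eq[OF part] by blast
    then show ?thesis using part True by (simp add: measurable_partition_def M)
  next
    case False
    then have "cell_index l A -` {h} = {}" using cell_index[OF part] by blast
    then show ?thesis by simp
  qed
  then show ?thesis
    by (subst measurable_count_space_eq2_countable) (auto simp: space)
qed

text \<open>Points are grouped by which balls of a finite cover contain them. The groups are Boolean
  combinations of balls, hence Borel, and two points of one group share a centre at distance below
  \<open>s / 2\<close>.\<close>

lemma small_measurable_partition_exists:
  assumes cpt: "compact (UNIV :: 'a::metric_space set)" and "s > 0"
  shows "\<exists>l (A :: nat \<Rightarrow> 'a set). measurable_partition l A \<and>
    (\<forall>h\<in>{1..l}. \<forall>x\<in>A h. \<forall>y\<in>A h. dist x y \<le> s)"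
proof -
  have "s / 2 > 0" using \<open>s > 0\<close> by simp
  from compact_UNIV_finite_small_cover[OF cpt this]
  obtain F :: "'a set" where F: "finite F" "\<And>x. \<exists>z\<in>F. dist z x < s / 2" by blast
  define g where "g x = {z \<in> F. dist z x < s / 2}" for x
  define P where "P = range (\<lambda>x. g -` {g x})"
  have "finite (range g)" using F(1) by (rule finite_subset[rotated, OF finite_Pow_iff[THEN iffD2]]) (auto simp: g_def)
  then have "finite ((\<lambda>v. g -` {v}) ` range g)" by simp
  then have P_fin: "finite P" by (simp add: P_def image_image)
  have P_part: "partition_on UNIV P"
    unfolding partition_on_def disjoint_def P_def by auto
  have P_sets: "C \<in> sets borel" if "C \<in> P" for C
  proof -
    obtain x where C: "C = g -` {g x}" using \<open>C \<in> P\<close> by (auto simp: P_def)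
    have "g y = g x \<longleftrightarrow> (\<forall>z\<in>F. z \<in> g x \<longleftrightarrow> dist z y < s / 2)" for y
      unfolding g_def by blast
    then have "C = - (\<Union>z\<in>F. if z \<in> g x then - ball z (s / 2) else ball z (s / 2))"
      unfolding C by (auto split: if_splits)
    also have "\<dots> \<in> sets borel"
      using F(1) by (intro borel_comp sets.finite_UN) (auto intro: borel_comp)
    finally show ?thesis .
  qed
  have P_small: "dist x y \<le> s" if C: "C \<in> P" "x \<in> C" "y \<in> C" for C x y
  proof -
    have "g x = g y" using C by (auto simp: P_def)
    moreover obtain z where "z \<in> g x" using F(2)[of x] by (auto simp: g_def)
    ultimately have "z \<in> g x" "z \<in> g y" by simp_all
    then have "dist z x < s / 2" "dist z y < s / 2" by (simp_all add: g_def)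
    then show ?thesis using dist_triangle[of x y z] by (simp add: dist_commute)
  qed
  obtain A where A: "bij_betw A {1..card P} P"
    using ex_bij_betw_nat_finite_1[OF P_fin] by blast
  then have img: "A ` {1..card P} = P" and "inj_on A {1..card P}" by (auto simp: bij_betw_def)
  then have "measurable_partition (card P) A"
    unfolding measurable_partition_def using P_part P_sets by auto
  then show ?thesis using P_small img by blast
qed

text \<open>Bridges the enumerations in (4) and (5) and unindexed finite families. Inserting
  \<open>{}\<close> provides an index even for the empty family, which can occur when
  \<open>\<epsilon> > 1\<close>.\<close>

lemma ex_indexed_family_iff:
  assumes "{} \<in> S"
  shows "(\<exists>k\<ge>1. \<exists>B :: nat \<Rightarrow> 'a set. (\<forall>i\<in>{1..k}. B i \<in> S) \<and> m (\<Union>i\<in>{1..k}. B i) \<and>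
      (\<forall>i\<in>{1..k}. \<forall>x\<in>B i. \<forall>y\<in>B i. R x y)) \<longleftrightarrow>
    (\<exists>\<B>. finite \<B> \<and> \<B> \<subseteq> S \<and> m (\<Union>\<B>) \<and> (\<forall>B\<in>\<B>. \<forall>x\<in>B. \<forall>y\<in>B. R x y))"
    (is "?L \<longleftrightarrow> ?R")
proof
  assume ?L
  then obtain k :: nat and B where B: "\<forall>i\<in>{1..k}. B i \<in> S" "m (\<Union>i\<in>{1..k}. B i)"
    "\<forall>i\<in>{1..k}. \<forall>x\<in>B i. \<forall>y\<in>B i. R x y" by (elim exE conjE)
  then show ?R by (intro exI[of _ "B ` {1..k}"]) auto
next
  assume ?R
  then obtain \<B> where \<B>: "finite \<B>" "\<B> \<subseteq> S" "m (\<Union>\<B>)" "\<forall>B\<in>\<B>. \<forall>x\<in>B. \<forall>y\<in>B. R x y"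
    by (elim exE conjE)
  have fin: "finite (insert {} \<B>)" using \<B>(1) by simp
  obtain B where "bij_betw B {1..card (insert {} \<B>)} (insert {} \<B>)"
    using ex_bij_betw_nat_finite_1[OF fin] by blast
  then have img: "B ` {1..card (insert {} \<B>)} = insert {} \<B>" by (simp add: bij_betw_def)
  have card: "card (insert {} \<B>) \<ge> 1" using \<B>(1) by (simp add: Suc_le_eq card_gt_0_iff)
  have mem: "B i \<in> insert {} \<B>" if "i \<in> {1..card (insert {} \<B>)}" for i
    using imageI[OF that, of B] by (simp only: img)
  have "B i \<in> S" if "i \<in> {1..card (insert {} \<B>)}" for i
    using mem[OF that] \<B>(2) assms by auto
  moreover have "m (\<Union>i\<in>{1..card (insert {} \<B>)}. B i)"
    using \<B>(3) unfolding img by simp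
  moreover have "R x y" if "i \<in> {1..card (insert {} \<B>)}" "x \<in> B i" "y \<in> B i" for i x y
    using mem[OF that(1)] that(2,3) \<B>(4) by auto
  ultimately show ?L
    using card by (intro exI[of _ "card (insert {} \<B>)"] exI[of _ B] conjI ballI)
qed

context compact_system
begin

lemma labelled_cell_index:
  assumes "measurable_partition l A"
  shows "labelled_system \<mu> T (cell_index l A)"
  using assms sets_borel by (intro labelled cell_index_measurable)

lemma hamming_eq_ham:
  assumes "measurable_partition l A"
  shows "hamming T l A n x y = labelled_system.ham T (cell_index l A) n x y"
  unfolding hamming_def name_at_eq_cell_index labelled_system.ham_def[OF labelled_cell_index[OF assms]] ..

text \<open>The bound \<open>card F \<le> k\<close> in \<open>spanned\<close> makes it monotone in
  \<open>k\<close>, so being spanned by \<open>k\<close> balls is the same as lying above the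
  attained minimum.\<close>

lemma spanning_number_le_iff:
  assumes part: "measurable_partition l A" and "e > 0"
  shows "spanning_number \<mu> T n l A e \<le> k \<longleftrightarrow> labelled_system.spanned \<mu> T (cell_index l A) k n e"
proof -
  interpret labelled_system \<mu> T "cell_index l A" using part by (rule labelled_cell_index)
  define Q where "Q m \<longleftrightarrow> (\<exists>F. finite F \<and> card F = m \<and> prob (\<Union>x\<in>F. {y. ham n x y < e}) > 1 - e)" for m
  have eq: "spanning_number \<mu> T n l A e = (LEAST m. Q m)"
    unfolding spanning_number_def Q_def hamming_ball_def hamming_eq_ham[OF part] ..
  have spanned_Q: "spanned k n e \<longleftrightarrow> (\<exists>m\<le>k. Q m)" for k
    unfolding spanned_def Q_def by auto
  have "\<exists>m. Q m"
    using spanned_exists[OF finite_range_cell_index[OF part] \<open>e > 0\<close>, of n] unfolding spanned_Q by blast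
  then have "Q (LEAST m. Q m)" by (rule LeastI_ex)
  then show ?thesis
    unfolding eq spanned_Q by (auto intro: Least_le order_trans)
qed

lemma dist_bounded: "\<exists>D>0. \<forall>x y :: 'a. dist x y \<le> D"
proof -
  obtain D where "\<And>x y :: 'a. dist x y \<le> D"
    using compact_imp_bounded[OF compact_UNIV] unfolding bounded_two_points by auto
  then have "\<forall>x y :: 'a. dist x y \<le> max D 1" by (metis max.coboundedI1)
  then show ?thesis by (intro exI[of _ "max D 1"]) auto
qed

lemma mu_equicontinuous_in_mean_if_ham_coverable:
  assumes "\<And>l A e. measurable_partition l A \<Longrightarrow> e > 0 \<Longrightarrow> labelled_system.ham_coverable \<mu> T (cell_index l A) e"
  shows "mu_equicontinuous_in_mean \<mu> T"
proof (rule equicontinuous_in_mean_if_mean_small_off)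
  fix e \<tau> :: real assume "e > 0" "\<tau> > 0"
  obtain D where D: "D > 0" "\<And>x y :: 'a. dist x y \<le> D" using dist_bounded by blast
  have "e / 3 > 0" using \<open>e > 0\<close> by simp
  from small_measurable_partition_exists[OF compact_UNIV this]
  obtain l and A :: "nat \<Rightarrow> 'a set" where A: "measurable_partition l A"
    "\<forall>h\<in>{1..l}. \<forall>x\<in>A h. \<forall>y\<in>A h. dist x y \<le> e / 3" by blast
  \<comment> \<open>The two terms are the two constraints of
    \<open>mean_small_off_if_ham_coverable\<close> with \<open>s = e / 3\<close>, whose conclusion
    is then at scale \<open>3 * s = e\<close>.\<close>
  define t where "t = min (e / 3 / D) (\<tau> / 2)"
  have t: "t > 0" "D * t \<le> e / 3" "2 * t \<le> \<tau>"
  proof -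
    show "t > 0" using \<open>e > 0\<close> \<open>\<tau> > 0\<close> D(1) by (simp add: t_def)
    have "D * t \<le> D * (e / 3 / D)" using D(1) by (intro mult_left_mono) (auto simp: t_def)
    then show "D * t \<le> e / 3" using D(1) by simp
  qed (simp add: t_def)
  have "dist x y \<le> e / 3" if "cell_index l A x = cell_index l A y" for x y
    using A(2) cell_index[OF A(1), of x] cell_index[OF A(1), of y] that by metis
  then have "mean_small_off (3 * (e / 3)) \<tau>"
    using \<open>e / 3 > 0\<close> D t assms[OF A(1) t(1)] cell_index_measurable[OF A(1) sets_borel]
    by (intro mean_small_off_if_ham_coverable[where c="cell_index l A" and D=D and t=t])
  then show "mean_small_off e \<tau>" by simp
qed

end

theorem theorem3p1:
  fixes T :: "'a::metric_space \<Rightarrow> 'a" and \<mu> :: "'a measure"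
  assumes compact_space: "compact (UNIV :: 'a set)"
    and homeo: "\<exists>S. homeomorphism UNIV UNIV T S"
    and borel_measure: "sets \<mu> = sets borel"
    and prob: "prob_space \<mu>"
    and invariant: "distr \<mu> \<mu> T = \<mu>"
  defines "S1 \<equiv> mu_mean_equicontinuous \<mu> T"
    and "S2 \<equiv> mu_equicontinuous_in_mean \<mu> T"
    and "S3 \<equiv> (\<forall>l A \<epsilon>. measurable_partition l A \<and> \<epsilon> > 0 \<longrightarrow>
           (\<exists>C>0. \<forall>n\<ge>1. real (spanning_number \<mu> T n l A \<epsilon>) \<le> C))"
    and "S4 \<equiv> (\<forall>l A \<epsilon>. measurable_partition l A \<and> \<epsilon> > 0 \<longrightarrow>
           (\<exists>k\<ge>1. \<exists>B :: nat \<Rightarrow> 'a set. (\<forall>i\<in>{1..k}. B i \<in> sets borel) \<and>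
              measure \<mu> (\<Union>i\<in>{1..k}. B i) > 1 - \<epsilon> \<and>
              (\<forall>i\<in>{1..k}. \<forall>x\<in>B i. \<forall>y\<in>B i.
                 limsup (\<lambda>n. ereal (hamming T l A n x y)) < ereal \<epsilon>)))"
    and "S5 \<equiv> (\<forall>l A \<epsilon>. measurable_partition l A \<and> \<epsilon> > 0 \<longrightarrow>
           (\<exists>k\<ge>1. \<exists>B :: nat \<Rightarrow> 'a set. (\<forall>i\<in>{1..k}. B i \<in> sets borel) \<and>
              measure \<mu> (\<Union>i\<in>{1..k}. B i) > 1 - \<epsilon> \<and>
              (\<forall>i\<in>{1..k}. \<forall>x\<in>B i. \<forall>y\<in>B i. \<forall>n\<ge>1. hamming T l A n x y < \<epsilon>)))"
  shows "(S1 \<longleftrightarrow> S2) \<and> (S2 \<longleftrightarrow> S3) \<and> (S3 \<longleftrightarrow> S4) \<and> (S4 \<longleftrightarrow> S5)"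
proof -
  have "continuous_on UNIV T" using homeo unfolding homeomorphism_def by blast
  then interpret compact_system T \<mu>
    by (rule compact_system.intro[OF compact_space _ borel_measure prob invariant])
  have S4_iff: "S4 \<longleftrightarrow> (\<forall>l A e. measurable_partition l A \<and> e > 0 \<longrightarrow>
      labelled_system.lham_coverable \<mu> T (cell_index l A) e)"
    unfolding S4_def
  proof (intro all_cong1 imp_cong refl)
    fix l and A :: "nat \<Rightarrow> 'a set" and e :: real
    assume "measurable_partition l A \<and> e > 0"
    then have part: "measurable_partition l A" by simp
    interpret labelled_system \<mu> T "cell_index l A" using part by (rule labelled_cell_index)
    show "(\<exists>k\<ge>1. \<exists>B :: nat \<Rightarrow> 'a set. (\<forall>i\<in>{1..k}. B i \<in> sets borel) \<and>
        measure \<mu> (\<Union>i\<in>{1..k}. B i) > 1 - e \<and>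
        (\<forall>i\<in>{1..k}. \<forall>x\<in>B i. \<forall>y\<in>B i.
           limsup (\<lambda>n. ereal (hamming T l A n x y)) < ereal e)) \<longleftrightarrow> lham_coverable e"
      unfolding lham_coverable_def lham_def hamming_eq_ham[OF part] sets_borel
      by (rule ex_indexed_family_iff) simp
  qed
  have S5_iff: "S5 \<longleftrightarrow> (\<forall>l A e. measurable_partition l A \<and> e > 0 \<longrightarrow>
      labelled_system.ham_coverable \<mu> T (cell_index l A) e)"
    unfolding S5_def
  proof (intro all_cong1 imp_cong refl)
    fix l and A :: "nat \<Rightarrow> 'a set" and e :: real
    assume "measurable_partition l A \<and> e > 0"
    then have part: "measurable_partition l A" by simp
    interpret labelled_system \<mu> T "cell_index l A" using part by (rule labelled_cell_index)
    show "(\<exists>k\<ge>1. \<exists>B :: nat \<Rightarrow> 'a set. (\<forall>i\<in>{1..k}. B i \<in> sets borel) \<and>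
        measure \<mu> (\<Union>i\<in>{1..k}. B i) > 1 - e \<and>
        (\<forall>i\<in>{1..k}. \<forall>x\<in>B i. \<forall>y\<in>B i. \<forall>n\<ge>1. hamming T l A n x y < e)) \<longleftrightarrow> ham_coverable e"
      unfolding ham_coverable_def hamming_eq_ham[OF part] sets_borel
      by (rule ex_indexed_family_iff) simp
  qed
  have S3_iff: "S3 \<longleftrightarrow> (\<forall>l A e. measurable_partition l A \<and> e > 0 \<longrightarrow>
      (\<exists>k>0. \<forall>n\<ge>1. labelled_system.spanned \<mu> T (cell_index l A) k n e))"
    unfolding S3_def
  proof (intro all_cong1 imp_cong refl)
    fix l and A :: "nat \<Rightarrow> 'a set" and e :: real
    assume "measurable_partition l A \<and> e > 0"
    then have iff: "labelled_system.spanned \<mu> T (cell_index l A) k n e \<longleftrightarrow> spanning_number \<mu> T n l A e \<le> k" for k n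
      by (simp add: spanning_number_le_iff)
    show "(\<exists>C>0. \<forall>n\<ge>1. real (spanning_number \<mu> T n l A e) \<le> C) \<longleftrightarrow>
        (\<exists>k>0. \<forall>n\<ge>1. labelled_system.spanned \<mu> T (cell_index l A) k n e)"
      unfolding iff
    proof
      assume "\<exists>C>0. \<forall>n\<ge>1. real (spanning_number \<mu> T n l A e) \<le> C"
      then obtain C where C: "C > 0" "\<forall>n\<ge>1. real (spanning_number \<mu> T n l A e) \<le> C" by blast
      have "spanning_number \<mu> T n l A e \<le> nat \<lceil>C\<rceil>" if "n \<ge> 1" for n
      proof -
        have "real (spanning_number \<mu> T n l A e) \<le> C" using C(2) that by blast
        also have "C \<le> real (nat \<lceil>C\<rceil>)" by (rule real_nat_ceiling_ge)
        finally show ?thesis by simp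
      qed
      moreover have "nat \<lceil>C\<rceil> > 0" using C(1) by simp
      ultimately show "\<exists>k>0. \<forall>n\<ge>1. spanning_number \<mu> T n l A e \<le> k" by blast
    next
      assume "\<exists>k>0. \<forall>n\<ge>1. spanning_number \<mu> T n l A e \<le> k"
      then obtain k where "k > 0" "\<forall>n\<ge>1. spanning_number \<mu> T n l A e \<le> k" by blast
      then show "\<exists>C>0. \<forall>n\<ge>1. real (spanning_number \<mu> T n l A e) \<le> C"
        by (intro exI[of _ "real k"]) auto
    qed
  qed
  \<comment> \<open>The implications are \<open>S1\<close> to \<open>S2\<close> and back, and the
    cycle \<open>S2\<close>, \<open>S3\<close>, \<open>S4\<close>, \<open>S5\<close>,
    \<open>S2\<close>.\<close>
  have "S1 \<Longrightarrow> S2"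
    unfolding S1_def S2_def
    by (intro equicontinuous_in_mean_if_mean_small_off mean_small_off_if_mean_equicontinuous)
  moreover have "S2 \<Longrightarrow> S1"
    unfolding S1_def S2_def by (rule mean_equicontinuous_if_in_mean)
  moreover have "S2 \<Longrightarrow> S3"
    unfolding S3_iff S2_def
    using spanned_if_equicontinuous_in_mean cell_index_measurable[OF _ sets_borel] finite_range_cell_index
    by blast
  moreover have "S3 \<Longrightarrow> S4"
    unfolding S3_iff S4_iff
    using labelled_system.lham_coverable_if_bounded_spanned[OF labelled_cell_index] by blast
  moreover have "S4 \<Longrightarrow> S5"
    unfolding S4_iff S5_iff
    using labelled_system.ham_coverable_if_lham_coverable[OF labelled_cell_index] finite_range_cell_index
    by (metis half_gt_zero)
  moreover have "S5 \<Longrightarrow> S2"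
    unfolding S5_iff S2_def using mu_equicontinuous_in_mean_if_ham_coverable by blast
  ultimately show ?thesis by blast
qed

end
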